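(* Let $A$ be a finite set with $|A|\ge2$ and let $\mathcal F,\mathcal G\subseteq\mathcal O(A)$ be symmetric conservative clones with $\chi(\mathcal F)=\chi(\mathcal G)$, i.e. $\mathrm r(\mathcal F)=\mathrm r(\mathcal G)$, $\mathrm R(\mathcal F)=\mathrm R(\mathcal G)$, $\mathrm D(\mathcal F)=\mathrm D(\mathcal G)$, and $\Pi(\mathcal F)=\Pi(\mathcal G)$ (in particular $\mathcal F|_{B^{<\omega}}=\mathcal G|_{B^{<\omega}}$ for every $B\in[A]^2$). Then $\mathcal F=\mathcal G$.
   Context: $\mathcal O(A)=\bigcup_{n<\omega}A^{A^n}$; $\mathcal F_{[n]}=\mathcal F\cap A^{A^n}$; $S_A$ is the set of permutations of $A$; $[A]^2$ the 2-element subsets of $A$. A clone with carrier $A$ is a subset of $\mathcal O(A)$ containing all projections and closed under composition. It is conservative if $f(\mathbf a)\in\mathrm{ran}\,\mathbf a$ (the set of entries of $\mathbf a$) for all members $f$ and all arguments $\mathbf a$. It is symmetric if for every member $f$ and $\sigma\in S_A$ the function $f_\sigma(\mathbf a)=\sigma^{-1}(f(\sigma(\mathbf a)))$ (σ applied componentwise) is also a member. $\mathrm r(\mathcal F)$ is the least $r$ such that $\mathcal F$ contains a non-projection $r$-ary function ($\omega$ if none). $\mathrm R_n(\mathcal F)$ is the binary relation on $A^n$: $\mathbf a\,\mathrm R_n(\mathcal F)\,\mathbf b$ iff there is $\sigma\in S_A$ with $f(\mathbf b)=\sigma(f(\mathbf a))$ for all $f\in\mathcal F_{[n]}$; $\mathrm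 D_n(\mathcal F)$ is the binary relation on $A^n$: $\mathbf a\,\mathrm D_n(\mathcal F)\,\mathbf b$ iff there are $a,b\in A$ with $f(\mathbf a)=a$ or $f(\mathbf b)=b$ for every $f\in\mathcal F_{[n]}$; $\mathrm R(\mathcal F)=\bigcup_n\mathrm R_n(\mathcal F)$, $\mathrm D(\mathcal F)=\bigcup_n\mathrm D_n(\mathcal F)$. For $B\subseteq A$, $\mathcal F|_{B^{<\omega}}=\{f|_{B^n}: n<\omega, f\in\mathcal F_{[n]}\}$, a clone with carrier $B$. $\Pi(\mathcal F)$ is a family, indexed by $B\in[A]^2$, of natural isomorphisms $(\sigma_B,\tau_B)$ from $\mathcal F|_{B^{<\omega}}$ onto a fixed representative Post class (clone on $\{0,1\}$), where $\sigma_B\colon B\to\{0,1\}$ is a bijection and $\tau_B$ a bijection of clones preserving arity with $\sigma_B(f(\mathbf a))=\tau_B(f)(\sigma_B(\mathbf a))$; equality $\Pi(\mathcal F)=\Pi(\mathcal G)$ means the families coincide, so the domains $\mathcal F|_{B^{<\omega}}$ and $\mathcal G|_{B^{<\omega}}$ coincide. $\chi(\mathcal F)=(\mathrm r(\mathcal F),\mathrm R(\mathcal F),\mathrm D(\mathcal F),\Pi(\mathcal F))$. *)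

theory Defs
  imports Main "HOL-Library.Extended_Nat"
begin

text \<open>An n-ary operation on carrier A is represented as a pair (n, f) with
  f :: 'a list => 'a, where tuples in A^n are lists of length n with entries in A,
  and f is extensional (undefined outside A^n).\<close>

type_synonym 'a op = "nat \<times> ('a list \<Rightarrow> 'a)"

definition tuples :: "'a set \<Rightarrow> nat \<Rightarrow> 'a list set" where
  "tuples A n = {x. length x = n \<and> set x \<subseteq> A}"

definition ops :: "'a set \<Rightarrow> 'a op set" where
  "ops A = {(n, f). (\<forall>x\<in>tuples A n. f x \<in> A) \<and> (\<forall>x. x \<notin> tuples A n \<longrightarrow> f x = undefined)}"

definition proj :: "'a set \<Rightarrow> nat \<Rightarrow> nat \<Rightarrow> 'a op" where
  "proj A n i = (n, \<lambda>x. if x \<in> tuples A n then x ! i else undefined)"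

definition comp_op :: "'a set \<Rightarrow> nat \<Rightarrow> 'a op \<Rightarrow> 'a op list \<Rightarrow> 'a op" where
  "comp_op A m f gs = (m, \<lambda>x. if x \<in> tuples A m then snd f (map (\<lambda>g. snd g x) gs) else undefined)"

definition clone :: "'a set \<Rightarrow> 'a op set \<Rightarrow> bool" where
  "clone A F \<longleftrightarrow> F \<subseteq> ops A \<and> (\<forall>n i. i < n \<longrightarrow> proj A n i \<in> F) \<and>
     (\<forall>f\<in>F. \<forall>gs m. set gs \<subseteq> F \<and> length gs = fst f \<and> (\<forall>g\<in>set gs. fst g = m)
        \<longrightarrow> comp_op A m f gs \<in> F)"

definition conservative :: "'a set \<Rightarrow> 'a op set \<Rightarrow> bool" where
  "conservative A F \<longleftrightarrow> (\<forall>(n, f)\<in>F. \<forall>x\<in>tuples A n. f x \<in> set x)"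

definition conj_op :: "'a set \<Rightarrow> ('a \<Rightarrow> 'a) \<Rightarrow> 'a op \<Rightarrow> 'a op" where
  "conj_op A \<sigma> p = (fst p, \<lambda>x. if x \<in> tuples A (fst p) then inv_into A \<sigma> (snd p (map \<sigma> x)) else undefined)"

definition symmetric_clone :: "'a set \<Rightarrow> 'a op set \<Rightarrow> bool" where
  "symmetric_clone A F \<longleftrightarrow> (\<forall>p\<in>F. \<forall>\<sigma>. bij_betw \<sigma> A A \<longrightarrow> conj_op A \<sigma> p \<in> F)"

definition is_proj :: "'a set \<Rightarrow> 'a op \<Rightarrow> bool" where
  "is_proj A p \<longleftrightarrow> (\<exists>i < fst p. p = proj A (fst p) i)"

definition rk :: "'a set \<Rightarrow> 'a op set \<Rightarrow> enat" where
  "rk A F = (if \<exists>p\<in>F. \<not> is_proj A p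
             then enat (LEAST n. \<exists>f. (n, f) \<in> F \<and> \<not> is_proj A (n, f))
             else \<infinity>)"

definition Rrel :: "'a set \<Rightarrow> 'a op set \<Rightarrow> ('a list \<times> 'a list) set" where
  "Rrel A F = {(a, b). \<exists>n. a \<in> tuples A n \<and> b \<in> tuples A n \<and>
      (\<exists>\<sigma>. bij_betw \<sigma> A A \<and> (\<forall>f. (n, f) \<in> F \<longrightarrow> f b = \<sigma> (f a)))}"

definition Drel :: "'a set \<Rightarrow> 'a op set \<Rightarrow> ('a list \<times> 'a list) set" where
  "Drel A F = {(a, b). \<exists>n. a \<in> tuples A n \<and> b \<in> tuples A n \<and>
      (\<exists>c\<in>A. \<exists>d\<in>A. \<forall>f. (n, f) \<in> F \<longrightarrow> f a = c \<or> f b = d)}"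

definition restr :: "'a op set \<Rightarrow> 'a set \<Rightarrow> 'a op set" where
  "restr F B = (\<lambda>(n, f). (n, \<lambda>x. if x \<in> tuples B n then f x else undefined)) ` F"

definition two_subsets :: "'a set \<Rightarrow> 'a set set" where
  "two_subsets A = {B. B \<subseteq> A \<and> card B = 2}"

definition nat_iso :: "'a set \<Rightarrow> 'a op set \<Rightarrow> ('a \<Rightarrow> bool) \<Rightarrow> ('a op \<Rightarrow> bool op) \<Rightarrow> bool op set \<Rightarrow> bool" where
  "nat_iso B C \<sigma> \<tau> P \<longleftrightarrow> bij_betw \<sigma> B UNIV \<and> bij_betw \<tau> C P \<and>
     (\<forall>p\<in>C. fst (\<tau> p) = fst p \<and> (\<forall>x\<in>tuples B (fst p). \<sigma> (snd p x) = snd (\<tau> p) (map \<sigma> x)))"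

text \<open>Fixed representative Post class of the isomorphism class: chosen from the set of all
  Post classes naturally isomorphic to C (this set depends only on the isomorphism class).\<close>
definition post_rep :: "'a set \<Rightarrow> 'a op set \<Rightarrow> bool op set" where
  "post_rep B C = (SOME P. P \<in> {Q. clone (UNIV :: bool set) Q \<and> (\<exists>\<sigma> \<tau>. nat_iso B C \<sigma> \<tau> Q)})"

definition Pi_fam :: "'a set \<Rightarrow> 'a op set \<Rightarrow>
    'a set \<Rightarrow> ('a op set \<times> bool op set \<times> ('a \<Rightarrow> bool) \<times> ('a op \<Rightarrow> bool op)) option" where
  "Pi_fam A F = (\<lambda>B. if B \<in> two_subsets A then
      Some (let C = restr F B; P = post_rep B C in
            (C, P, SOME (\<sigma>, \<tau>). nat_iso B C \<sigma> \<tau> P))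
    else None)"

definition chi :: "'a set \<Rightarrow> 'a op set \<Rightarrow> enat \<times> ('a list \<times> 'a list) set \<times> ('a list \<times> 'a list) set \<times>
    ('a set \<Rightarrow> ('a op set \<times> bool op set \<times> ('a \<Rightarrow> bool) \<times> ('a op \<Rightarrow> bool op)) option)" where
  "chi A F = (rk A F, Rrel A F, Drel A F, Pi_fam A F)"

end

theory Submission
  imports Defs "HOL-Library.FuncSet"
begin

text \<open>
  A member \<open>f\<close> of \<open>G\<close> is interpolated by members of \<open>F\<close> on larger and larger sets of tuples.
  The two clones agree on two-element subsets, and \<open>R\<close> spreads this agreement to all pairs on
  which binary members make the same choices, so \<open>f\<close> agrees with some member of \<open>F\<close> on all
  tuples with at most two distinct entries. If \<open>F\<close> contains a semiprojection (a \<open>k\<close>-ary nonprojection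
  that returns its first argument unless all arguments are distinct), then it allows a member to be
  changed at one tuple with at least \<open>k\<close> distinct entries while leaving all tuples unrelated by \<open>R\<close>
  alone, and interpolation goes through.

  A ternary semiprojection exists if some binary member is not a projection, and also if all binary
  members are projections but \<open>F\<close> contains a minority operation. If all binary members are projections
  and \<open>F\<close> contains a majority operation, interpolation reduces to two tuples \<open>a\<close>, \<open>b\<close>
  (Baker--Pixley); there the value pairs of \<open>F\<close> form a full rectangle, the graph of a bijection, which
  is seen by \<open>R\<close>, or a cross, which is seen by \<open>D\<close>. In the remaining case \<open>F\<close> acts by
  projections on every two-element set, and a nonprojection of least arity \<open>r\<close> is a semiprojection up
  to the order of its arguments.
\<close>

section \<open>Extensionality of operations and extension of injections to permutations\<close>

lemma op_eqI:
  assumes "(n, f) \<in> ops A" and "(n, g) \<in> ops A" and "\<And>x. x \<in> tuples A n \<Longrightarrow> f x = g x"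
  shows "f = g"
  using assms by (fastforce simp: ops_def)

text \<open>The complements of \<open>B\<close> and of its image have the same finite size, so a
  bijection between them completes \<open>f\<close>.\<close>

lemma extend_to_permutation:
  assumes "finite A" "B \<subseteq> A" "inj_on f B" "f ` B \<subseteq> A"
  shows "\<exists>\<sigma>. bij_betw \<sigma> A A \<and> (\<forall>x\<in>B. \<sigma> x = f x)"
proof -
  have "card (f ` B) = card B" using assms(3) by (rule card_image)
  then have "card (A - B) = card (A - f ` B)"
    using assms by (simp add: card_Diff_subset finite_subset)
  then obtain g where g: "bij_betw g (A - B) (A - f ` B)"
    using assms(1) by (meson finite_Diff finite_same_card_bij)
  define \<sigma> where "\<sigma> x = (if x \<in> B then f x else g x)" for x
  have 1: "bij_betw \<sigma> B (f ` B)"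
    using assms(3) by (auto simp: \<sigma>_def bij_betw_def inj_on_def)
  have 2: "bij_betw \<sigma> (A - B) (A - f ` B)"
    using g by (rule bij_betw_cong[THEN iffD1, rotated]) (auto simp: \<sigma>_def)
  have "bij_betw \<sigma> (B \<union> (A - B)) (f ` B \<union> (A - f ` B))"
    by (rule bij_betw_combine[OF 1 2]) auto
  moreover have "B \<union> (A - B) = A" "f ` B \<union> (A - f ` B) = A" using assms by auto
  ultimately show ?thesis by (auto simp: \<sigma>_def)
qed

text \<open>Together with conjugation this moves the behaviour of a member at one tuple of distinct
  entries to any other such tuple.\<close>

lemma extend_lists_to_permutation:
  assumes "finite A" "distinct xs" "distinct ys" "length xs = length ys" "set xs \<subseteq> A" "set ys \<subseteq> A"
  shows "\<exists>\<sigma>. bij_betw \<sigma> A A \<and> map \<sigma> xs = ys"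
proof -
  define g where "g x = the (map_of (zip xs ys) x)" for x
  have g: "g (xs ! i) = ys ! i" if "i < length xs" for i
    using that assms by (simp add: g_def map_of_zip_nth)
  have "inj_on g (set xs)" 
    using assms g by (auto simp: inj_on_def in_set_conv_nth nth_eq_iff_index_eq)
  moreover have "g ` set xs \<subseteq> A"
  proof -
    have "g x \<in> set ys" if "x \<in> set xs" for x
      using that g assms(4) by (metis in_set_conv_nth)
    then show ?thesis using assms(6) by blast
  qed
  ultimately obtain \<sigma> where "bij_betw \<sigma> A A" "\<forall>x\<in>set xs. \<sigma> x = g x"
    using extend_to_permutation[of A "set xs" g] assms by auto
  then show ?thesis using g assms by (intro exI[of _ \<sigma>]) (auto intro!: nth_equalityI)
qed

section \<open>Closure properties of one conservative symmetric clone\<close>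

locale conservative_symmetric_clone =
  fixes A :: "'a set" and F :: "'a op set"
  assumes fin: "finite A" and clone: "clone A F"
    and conservative: "conservative A F" and symmetric: "symmetric_clone A F"
begin

lemma in_ops: "p \<in> F \<Longrightarrow> p \<in> ops A"
  using clone by (auto simp: clone_def)

lemma value_in_set: "(n, f) \<in> F \<Longrightarrow> x \<in> tuples A n \<Longrightarrow> f x \<in> set x"
  using conservative by (auto simp: conservative_def)

lemma value_in_carrier: "(n, f) \<in> F \<Longrightarrow> x \<in> tuples A n \<Longrightarrow> f x \<in> A"
  using value_in_set by (fastforce simp: tuples_def)

lemma finite_tuples: "finite (tuples A n)"
  using finite_lists_length_eq[OF fin, of n] by (simp add: tuples_def conj_commute)

lemma finite_members: "finite {f. (n, f) \<in> F}"
proof (rule finite_subset)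
  show "{f. (n, f) \<in> F} \<subseteq> PiE (tuples A n) (\<lambda>_. A)"
    using in_ops by (fastforce simp: ops_def PiE_def extensional_def)
  show "finite (PiE (tuples A n) (\<lambda>_. A))"
    by (intro finite_PiE finite_tuples fin)
qed

lemma projection: "i < n \<Longrightarrow> \<exists>u. (n, u) \<in> F \<and> (\<forall>x\<in>tuples A n. u x = x ! i)"
  using clone by (fastforce simp: clone_def proj_def)

lemma value_attained:
  assumes "a \<in> tuples A n" "c \<in> set a"
  shows "\<exists>u. (n, u) \<in> F \<and> u a = c"
  using assms projection by (metis (mono_tags, lifting) in_set_conv_nth mem_Collect_eq tuples_def)

lemma composition:
  assumes "(k, f) \<in> F" "length us = k" "\<And>u. u \<in> set us \<Longrightarrow> (n, u) \<in> F"
  shows "\<exists>h. (n, h) \<in> F \<and> (\<forall>x\<in>tuples A n. h x = f (map (\<lambda>u. u x) us))"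
proof -
  have "comp_op A n (k, f) (map (Pair n) us) \<in> F"
    using clone assms unfolding clone_def
    by (elim conjE ballE[where x = "(k, f)"] allE[where x = "map (Pair n) us"] allE[where x = n]) auto
  then show ?thesis by (force simp: comp_op_def comp_def)
qed

lemma composition2:
  assumes "(2, f) \<in> F" "(n, u) \<in> F" "(n, v) \<in> F"
  shows "\<exists>h. (n, h) \<in> F \<and> (\<forall>x\<in>tuples A n. h x = f [u x, v x])"
  using composition[OF assms(1), of "[u, v]" n] assms by fastforce

lemma composition3:
  assumes "(3, f) \<in> F" "(n, u) \<in> F" "(n, v) \<in> F" "(n, w) \<in> F"
  shows "\<exists>h. (n, h) \<in> F \<and> (\<forall>x\<in>tuples A n. h x = f [u x, v x, w x])"
  using composition[OF assms(1), of "[u, v, w]" n] assms by fastforce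

text \<open>Composition with projections: \<open>js\<close> names, for each argument place of
  \<open>f\<close>, the coordinate read there. This covers both permuting and identifying
  arguments.\<close>

lemma minor:
  assumes "(n, f) \<in> F" "length js = n" "set js \<subseteq> {..<m}"
  shows "\<exists>h. (m, h) \<in> F \<and> (\<forall>x\<in>tuples A m. h x = f (map ((!) x) js))"
proof -
  obtain P where P: "\<And>i. i < m \<Longrightarrow> (m, P i) \<in> F \<and> (\<forall>x\<in>tuples A m. P i x = x ! i)"
  proof -
    have "\<exists>P. \<forall>i. i < m \<longrightarrow> (m, P i) \<in> F \<and> (\<forall>x\<in>tuples A m. P i x = x ! i)"
      using projection by (intro choice) blast
    then show ?thesis using that by blast
  qed
  obtain h where "(m, h) \<in> F" "\<forall>x\<in>tuples A m. h x = f (map (\<lambda>u. u x) (map P js))"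
    using composition[OF assms(1), of "map P js" m] assms P by auto
  moreover have "map (\<lambda>u. u x) (map P js) = map ((!) x) js" if "x \<in> tuples A m" for x
    using P that assms by (auto simp: subset_iff)
  ultimately show ?thesis by (metis (no_types, lifting))
qed

lemma conjugate:
  assumes "bij_betw \<sigma> A A" "(n, f) \<in> F"
  shows "\<exists>h. (n, h) \<in> F \<and> (\<forall>x\<in>tuples A n. \<sigma> (h x) = f (map \<sigma> x))"
proof -
  have "conj_op A \<sigma> (n, f) \<in> F"
    using symmetric assms by (auto simp: symmetric_clone_def)
  moreover have mapped: "map \<sigma> x \<in> tuples A n" if "x \<in> tuples A n" for x
    using that assms(1) by (auto simp: tuples_def bij_betw_def)
  moreover have "\<sigma> (inv_into A \<sigma> (f (map \<sigma> x))) = f (map \<sigma> x)" if "x \<in> tuples A n" for x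
    using mapped[OF that] value_in_carrier[OF assms(2)] assms(1) by (metis bij_betw_inv_into_right)
  ultimately show ?thesis
    by (auto simp: conj_op_def)
qed

text \<open>Two variables are placed according to the pattern \<open>bs\<close>. Thus binary members
  govern the values of every member at two-valued tuples.\<close>

lemma binary_minor:
  assumes "(n, f) \<in> F" "length bs = n"
  shows "\<exists>t. (2, t) \<in> F \<and> (\<forall>x\<in>A. \<forall>y\<in>A. t [x, y] = f (map (\<lambda>b. if b then x else y) bs))"
proof -
  obtain t where t: "(2, t) \<in> F"
      "\<forall>x\<in>tuples A 2. t x = f (map ((!) x) (map (\<lambda>b. if b then 0 else 1) bs))"
    using minor[OF assms(1), of "map (\<lambda>b. if b then 0 else 1) bs" 2] assms by (force split: if_splits)
  have "map ((!) [x, y]) (map (\<lambda>b. if b then 0 else 1) bs) = map (\<lambda>b. if b then x else y) bs" for x y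
    by auto
  moreover have "[x, y] \<in> tuples A 2" if "x \<in> A" "y \<in> A" for x y using that by (simp add: tuples_def)
  ultimately show ?thesis using t by metis
qed

text \<open>The map taking \<open>u a\<close> to \<open>u b\<close> is well defined and injective,
  so it extends to a permutation. In contrapositive form: at unrelated tuples some two members agree
  at exactly one of the two.\<close>

lemma related_if_same_kernel:
  assumes "a \<in> tuples A n" "b \<in> tuples A n"
    and "\<And>u v. (n, u) \<in> F \<Longrightarrow> (n, v) \<in> F \<Longrightarrow> u a = v a \<longleftrightarrow> u b = v b"
  shows "(a, b) \<in> Rrel A F"
proof -
  define B where "B = {u a | u. (n, u) \<in> F}"
  define g where "g c = (SOME u. (n, u) \<in> F \<and> u a = c) b" for c
  have g: "g (u a) = u b" if "(n, u) \<in> F" for u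
  proof -
    let ?v = "SOME v. (n, v) \<in> F \<and> v a = u a"
    have "(n, ?v) \<in> F \<and> ?v a = u a" using that someI[of "\<lambda>v. (n, v) \<in> F \<and> v a = u a" u] by simp
    then show ?thesis using assms(3)[of ?v u] that by (simp add: g_def)
  qed
  have "\<exists>\<sigma>. bij_betw \<sigma> A A \<and> (\<forall>x\<in>B. \<sigma> x = g x)"
  proof (rule extend_to_permutation[OF fin])
    show "B \<subseteq> A" using value_in_carrier assms(1) by (auto simp: B_def)
    show "g ` B \<subseteq> A" using value_in_carrier assms(2) g by (auto simp: B_def)
    show "inj_on g B"
    proof (rule inj_onI)
      fix c d assume "c \<in> B" "d \<in> B" and eq: "g c = g d"
      then obtain u v where uv: "c = u a" "d = v a" "(n, u) \<in> F" "(n, v) \<in> F" by (auto simp: B_def)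
      then show "c = d" using assms(3)[of u v] g[of u] g[of v] eq by simp
    qed
  qed
  then obtain \<sigma> where "bij_betw \<sigma> A A" "\<And>u. (n, u) \<in> F \<Longrightarrow> u b = \<sigma> (u a)"
    using g unfolding B_def by (metis (mono_tags, lifting) mem_Collect_eq)
  then show ?thesis using assms(1,2) unfolding Rrel_def by blast
qed

subsection \<open>Semiprojections\<close>

definition semiprojection :: "nat \<Rightarrow> ('a list \<Rightarrow> 'a) \<Rightarrow> bool" where
  "semiprojection k s \<longleftrightarrow> (k, s) \<in> F \<and> (\<forall>x\<in>tuples A k. \<not> distinct x \<longrightarrow> s x = x ! 0) \<and>
     (\<exists>x\<in>tuples A k. s x \<noteq> x ! 0)"

text \<open>At some \<open>x\<close> the value of \<open>s\<close> is an entry other than the first.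
  A permutation of the arguments moves that entry to place 1, and conjugation then carries the tuple
  to \<open>y\<close>; both respect the fallback to place 0.\<close>

lemma semiprojection_second_at:
  assumes "semiprojection k s" "2 \<le> k" "y \<in> tuples A k" "distinct y"
  shows "\<exists>s'. (k, s') \<in> F \<and> (\<forall>x\<in>tuples A k. \<not> distinct x \<longrightarrow> s' x = x ! 0) \<and> s' y = y ! 1"
proof -
  have s: "(k, s) \<in> F" "\<And>x. x \<in> tuples A k \<Longrightarrow> \<not> distinct x \<Longrightarrow> s x = x ! 0"
    using assms(1) by (auto simp: semiprojection_def)
  obtain x where x: "x \<in> tuples A k" "s x \<noteq> x ! 0"
    using assms(1) by (auto simp: semiprojection_def)
  obtain j where j: "j < k" "s x = x ! j"
    using value_in_set[OF s(1) x(1)] x(1) by (auto simp: in_set_conv_nth tuples_def)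
  \<comment> \<open>Places 1 and \<open>j\<close> are exchanged. Place 0 stays fixed, because
    \<open>j\<close> is not 0.\<close>
  define swap where "swap i = (if i = 1 then j else if i = j then 1 else i)" for i :: nat
  define js where "js = map swap [0..<k]"
  have swap: "swap (swap i) = i" for i by (simp add: swap_def)
  have swap_less: "swap i < k" if "i < k" for i using that j assms(2) by (simp add: swap_def)
  have "swap 0 = 0" using x(2) j by (cases j) (auto simp: swap_def)
  have js: "distinct js" "length js = k" "set js \<subseteq> {..<k}"
    using swap_less swap by (auto simp: js_def distinct_map inj_on_def) metis
  let ?perm = "\<lambda>w. map ((!) w) js"
  have perm_perm: "?perm (?perm w) = w" if "length w = k" for w :: "'a list"
    using that swap swap_less by (intro nth_equalityI) (auto simp: js_def)
  have perm_in: "?perm w \<in> tuples A k" if "w \<in> tuples A k" for w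
    using that js swap_less by (auto simp: tuples_def js_def subset_iff)
  have perm_distinct: "distinct (?perm w)" if "distinct w" "length w = k" for w :: "'a list"
    using that js by (auto simp: distinct_map inj_on_def nth_eq_iff_index_eq subset_iff)
  obtain s1 where s1: "(k, s1) \<in> F" "\<And>w. w \<in> tuples A k \<Longrightarrow> s1 w = s (?perm w)"
    using minor[OF s(1) js(2,3)] by auto
  have "distinct x" using s(2) x by blast
  then have x': "?perm x \<in> tuples A k" "distinct (?perm x)" "length (?perm x) = k"
    using perm_in perm_distinct x by (auto simp: tuples_def js)
  obtain \<sigma> where \<sigma>: "bij_betw \<sigma> A A" "map \<sigma> y = ?perm x"
    using extend_lists_to_permutation[OF fin assms(4) x'(2)] assms(3) x' by (auto simp: tuples_def)
  obtain s2 where s2: "(k, s2) \<in> F" "\<And>z. z \<in> tuples A k \<Longrightarrow> \<sigma> (s2 z) = s1 (map \<sigma> z)"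
    using conjugate[OF \<sigma>(1) s1(1)] by blast
  have cancel: "c = d" if "\<sigma> c = \<sigma> d" "c \<in> A" "d \<in> A" for c d
    using that \<sigma>(1) by (auto simp: bij_betw_def inj_on_def)
  have nth_in: "z ! i \<in> A" if "z \<in> tuples A k" "i < k" for z i
    using that by (auto simp: tuples_def)
  have "s2 z = z ! 0" if z: "z \<in> tuples A k" "\<not> distinct z" for z
  proof -
    have mz: "map \<sigma> z \<in> tuples A k" using z \<sigma>(1) by (auto simp: tuples_def bij_betw_def)
    have "\<not> distinct (map \<sigma> z)" using z(2) distinct_map by blast
    moreover have len: "length (map \<sigma> z) = k" using z by (simp add: tuples_def)
    ultimately have nd: "\<not> distinct (?perm (map \<sigma> z))"
      using perm_distinct[of "?perm (map \<sigma> z)"] js(2) unfolding perm_perm[OF len] by auto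
    have "\<sigma> (s2 z) = ?perm (map \<sigma> z) ! 0"
      using s2(2)[OF z(1)] s1(2)[OF mz] s(2)[OF perm_in[OF mz] nd] by simp
    also have "\<dots> = \<sigma> (z ! 0)"
      using \<open>swap 0 = 0\<close> assms(2) z by (simp add: js_def tuples_def)
    finally show ?thesis using cancel value_in_carrier[OF s2(1) z(1)] nth_in z assms(2) by simp
  qed
  moreover have "s2 y = y ! 1"
  proof -
    have "\<sigma> (s2 y) = s x"
      using s2 assms(3) \<sigma>(2) s1 x'(1) perm_perm x by (simp add: tuples_def)
    also have "\<dots> = ?perm x ! 1" using j assms(2) by (simp add: js_def swap_def)
    also have "\<dots> = \<sigma> (y ! 1)" using \<sigma>(2)[symmetric] assms(2,3) by (simp add: tuples_def)
    finally show ?thesis using cancel value_in_carrier[OF s2(1)] nth_in assms by simp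
  qed
  ultimately show ?thesis using s2(1) by blast
qed

text \<open>
  The semiprojection is applied to \<open>u\<close>, \<open>v\<close>, \<open>w\<close> and projections chosen so that all its arguments
  are distinct at \<open>a\<close>; wherever two arguments coincide the result falls back to \<open>u\<close>.
\<close>
lemma collapse:
  assumes "semiprojection k s" "3 \<le> k" and a: "a \<in> tuples A n" "k \<le> card (set a)"
    and F: "(n, u) \<in> F" "(n, v) \<in> F" "(n, w) \<in> F" and dist: "distinct [u a, v a, w a]"
  shows "\<exists>h. (n, h) \<in> F \<and> h a = v a \<and>
    (\<forall>b\<in>tuples A n. card (set b) < k \<or> u b = v b \<or> u b = w b \<or> v b = w b \<longrightarrow> h b = u b)"
proof -
  have sub: "{u a, v a, w a} \<subseteq> set a" using value_in_set F a by blast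
  have "card {u a, v a, w a} = 3" using dist by simp
  then have "k - 3 \<le> card (set a - {u a, v a, w a})"
    using sub a by (simp add: card_Diff_subset)
  then obtain T where T: "T \<subseteq> set a - {u a, v a, w a}" "card T = k - 3" "finite T"
    by (rule obtain_subset_with_card_n)
  obtain cs where cs: "set cs = T" "distinct cs" using finite_distinct_list[OF T(3)] by blast
  have "\<exists>p. (n, p) \<in> F \<and> p a = c" if "c \<in> T" for c
    using value_attained[OF a(1)] that T by blast
  then obtain P where P: "\<And>c. c \<in> T \<Longrightarrow> (n, P c) \<in> F \<and> P c a = c" by metis
  define us where "us = u # v # w # map P cs"
  have us: "length us = k" "\<And>p. p \<in> set us \<Longrightarrow> (n, p) \<in> F"
    using assms(2) T cs distinct_card[of cs] F P by (auto simp: us_def)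
  let ?at = "\<lambda>b. map (\<lambda>p. p b) us"
  have at_in: "?at b \<in> tuples A k" "set (?at b) \<subseteq> set b" if "b \<in> tuples A n" for b
    using us value_in_set that by (auto simp: tuples_def subset_iff)
  have "map (\<lambda>c. P c a) cs = cs" using P cs by (intro map_idI) auto
  then have "?at a = [u a, v a, w a] @ cs" by (simp add: us_def comp_def)
  then have "distinct (?at a)" using dist cs T by auto
  then obtain s' where s': "(k, s') \<in> F" "\<And>x. x \<in> tuples A k \<Longrightarrow> \<not> distinct x \<Longrightarrow> s' x = x ! 0"
      "s' (?at a) = ?at a ! 1"
    using semiprojection_second_at[OF assms(1) _ at_in(1)[OF a(1)]] assms(2) by auto
  obtain h where h: "(n, h) \<in> F" "\<And>b. b \<in> tuples A n \<Longrightarrow> h b = s' (?at b)"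
    using composition[OF s'(1) us] by blast
  have "h b = u b" if b: "b \<in> tuples A n"
    and "card (set b) < k \<or> u b = v b \<or> u b = w b \<or> v b = w b" for b
  proof -
    \<comment> \<open>By conservativity all \<open>k\<close> arguments are entries of
      \<open>b\<close>, which are too few to be distinct.\<close>
    have "\<not> distinct (?at b)" if "card (set b) < k"
    proof
      assume "distinct (?at b)"
      then have "card (set (?at b)) = k" using us(1) by (simp add: distinct_card del: set_map)
      then show False using card_mono[OF _ at_in(2)[OF b]] that by simp
    qed
    then have "\<not> distinct (?at b)" using that by (auto simp: us_def)
    then show ?thesis using h(2) s'(2) at_in(1) b by (simp add: us_def)
  qed
  moreover have "h a = v a" using h(2) s'(3) a by (simp add: us_def)
  ultimately show ?thesis using h(1) by blast
qed

end

section \<open>Two clones with the same relation R\<close>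

locale clone_pair =
  F: conservative_symmetric_clone A F + G: conservative_symmetric_clone A G
  for A :: "'a set" and F G +
  assumes Rrel_eq: "Rrel A F = Rrel A G"
begin

text \<open>R provides a permutation for each clone. Both clones contain the projections, so the two
  permutations coincide on the entries of \<open>a\<close>, and by conservativity all values lie
  there.\<close>

lemma related_agree_iff:
  assumes "(a, b) \<in> Rrel A F" "a \<in> tuples A n" "(n, g) \<in> F" "(n, f) \<in> G"
  shows "f a = g a \<longleftrightarrow> f b = g b"
proof -
  obtain \<sigma> where \<sigma>: "bij_betw \<sigma> A A" "\<And>u. (n, u) \<in> F \<Longrightarrow> u b = \<sigma> (u a)" and b: "b \<in> tuples A n"
    using assms(1,2) by (auto simp: Rrel_def tuples_def)
  obtain \<tau> where \<tau>: "\<And>u. (n, u) \<in> G \<Longrightarrow> u b = \<tau> (u a)"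
    using assms(1,2) unfolding Rrel_eq by (auto simp: Rrel_def tuples_def)
  have eq: "\<sigma> c = \<tau> c" if "c \<in> set a" for c
  proof -
    have "length a = n" using assms(2) by (simp add: tuples_def)
    then obtain i where i: "i < n" "c = a ! i" using \<open>c \<in> set a\<close> by (metis in_set_conv_nth)
    then show ?thesis using F.projection[OF i(1)] G.projection[OF i(1)] \<sigma>(2) \<tau> assms(2) b by metis
  qed
  have "f b = \<sigma> (f a)" using \<tau>[OF assms(4)] eq G.value_in_set[OF assms(4,2)] by simp
  moreover have "g b = \<sigma> (g a)" using \<sigma>(2) assms(3) by simp
  moreover have "f a \<in> A" "g a \<in> A"
    using F.value_in_carrier G.value_in_carrier assms by blast+
  ultimately show ?thesis using \<sigma>(1) by (metis bij_betw_inv_into_left)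
qed

end

lemma third_element:
  assumes "3 \<le> card X"
  shows "\<exists>z\<in>X. z \<noteq> x \<and> z \<noteq> y"
proof (rule ccontr)
  assume "\<not> ?thesis"
  then have "X \<subseteq> {x, y}" by blast
  then have "card X \<le> card {x, y}" by (intro card_mono) auto
  also have "\<dots> \<le> 2" by (simp add: card_insert_if)
  finally show False using assms by simp
qed

section \<open>Prescribing one or two values by means of a semiprojection\<close>

context conservative_symmetric_clone
begin

lemma adjust_value:
  assumes "semiprojection k s" "3 \<le> k" "a \<in> tuples A n" "k \<le> card (set a)"
    and "(n, u) \<in> F" "c \<in> set a"
  shows "\<exists>h. (n, h) \<in> F \<and> h a = c \<and> (\<forall>b\<in>tuples A n. card (set b) < k \<longrightarrow> h b = u b)"
proof (cases "u a = c")
  case False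
  obtain z where z: "z \<in> set a" "z \<noteq> u a" "z \<noteq> c"
    using third_element[of "set a" "u a" c] assms by auto
  obtain v w where "(n, v) \<in> F" "v a = c" "(n, w) \<in> F" "w a = z"
    using value_attained[OF assms(3)] assms(6) z(1) by metis
  then show ?thesis
    using collapse[OF assms(1-5), of v w] z False by auto
qed (use assms in blast)

text \<open>The pair \<open>u\<close>, \<open>v\<close> separates \<open>b\<close> from
  \<open>a\<close>. It yields members with value \<open>u a\<close> at \<open>a\<close> and any
  chosen entry at \<open>b\<close>. Two of these agree at \<open>a\<close>, so using them in
  \<open>collapse\<close> alters \<open>p\<close> at \<open>b\<close> but not at
  \<open>a\<close>.\<close>

lemma adjust_value_fixing:
  assumes "semiprojection k s" "3 \<le> k" and a: "a \<in> tuples A n" and b: "b \<in> tuples A n" "k \<le> card (set b)"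
    and uv: "(n, u) \<in> F" "(n, v) \<in> F" "u a = v a" "u b \<noteq> v b"
    and p: "(n, p) \<in> F" "d \<in> set b"
  shows "\<exists>h. (n, h) \<in> F \<and> h a = p a \<and> h b = d \<and> (\<forall>x\<in>tuples A n. card (set x) < k \<longrightarrow> h x = p x)"
proof -
  \<comment> \<open>For a value other than \<open>u b\<close> and \<open>v b\<close>,
    \<open>collapse\<close> is applied to \<open>u\<close>, \<open>q\<close>, \<open>v\<close>: it
    gives \<open>q b\<close> at \<open>b\<close>, and falls back to \<open>u a\<close> at
    \<open>a\<close> since \<open>u\<close> and \<open>v\<close> agree there.\<close>
  have row: "\<exists>h. (n, h) \<in> F \<and> h a = u a \<and> h b = e" if e: "e \<in> set b" for e
  proof -
    obtain q where q: "(n, q) \<in> F" "q b = e" using value_attained[OF b(1) e] by blast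
    show ?thesis
    proof (cases "e = u b \<or> e = v b")
      case False
      then have "distinct [u b, q b, v b]" using q uv(4) by auto
      then show ?thesis
        using collapse[OF assms(1,2) b uv(1) q(1) uv(2)] uv(3) a q(2) by metis
    qed (use uv in metis)
  qed
  show ?thesis
  proof (cases "p b = d")
    case False
    obtain z where z: "z \<in> set b" "z \<noteq> p b" "z \<noteq> d"
      using third_element[of "set b" "p b" d] assms by auto
    obtain q where q: "(n, q) \<in> F" "q a = u a" "q b = d" using row[OF p(2)] by blast
    obtain w where w: "(n, w) \<in> F" "w a = u a" "w b = z" using row[OF z(1)] by blast
    have "distinct [p b, q b, w b]" using z False q w by auto
    from collapse[OF assms(1,2) b p(1) q(1) w(1) this]
    obtain h where h: "(n, h) \<in> F" "h b = q b"
      "\<And>x. x \<in> tuples A n \<Longrightarrow> card (set x) < k \<or> p x = q x \<or> p x = w x \<or> q x = w x \<Longrightarrow> h x = p x"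
      by blast
    have "h a = p a" using h(3)[OF a] q(2) w(2) by simp
    then show ?thesis using h q(3) by blast
  qed (use p in blast)
qed

lemma adjust_two_values:
  assumes "semiprojection k s" "3 \<le> k"
    and a: "a \<in> tuples A n" "k \<le> card (set a)" and b: "b \<in> tuples A n" "k \<le> card (set b)"
    and "(a, b) \<notin> Rrel A F" and p: "(n, p) \<in> F" "c \<in> set a" "d \<in> set b"
  shows "\<exists>h. (n, h) \<in> F \<and> h a = c \<and> h b = d"
proof -
  obtain u v where uv: "(n, u) \<in> F" "(n, v) \<in> F" "u a = v a \<longleftrightarrow> u b \<noteq> v b"
    using related_if_same_kernel[OF a(1) b(1)] assms(7) by blast
  show ?thesis
  proof (cases "u a = v a")
    case True
    obtain q where "(n, q) \<in> F" "q a = c" using value_attained[OF a(1) p(2)] by blast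
    then show ?thesis
      using adjust_value_fixing[OF assms(1,2) a(1) b uv(1,2) True _ _ p(3), of q] uv(3) True by auto
  next
    case False
    obtain q where "(n, q) \<in> F" "q b = d" using value_attained[OF b(1) p(3)] by blast
    then show ?thesis
      using adjust_value_fixing[OF assms(1,2) b(1) a uv(1,2) _ False _ p(2), of q] uv(3) False by auto
  qed
qed

end

section \<open>Interpolation in the presence of a semiprojection\<close>

context clone_pair
begin

text \<open>Induction on the set \<open>S\<close> of tuples with at least \<open>k\<close> distinct
  entries at which \<open>f\<close> is to be matched. An interpolant \<open>u\<close> that may fail
  at \<open>x\<close> and one \<open>v\<close> that may fail at \<open>y\<close> are merged by
  \<open>collapse\<close> at \<open>x\<close>.\<close>

lemma member_if_semiprojection:
  assumes semi: "F.semiprojection k s" "3 \<le> k" and f: "(n, f) \<in> G" and f': "(n, f') \<in> F"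
    and low: "\<And>a. a \<in> tuples A n \<Longrightarrow> card (set a) < k \<Longrightarrow> f a = f' a"
  shows "(n, f) \<in> F"
proof -
  define H where "H = {a \<in> tuples A n. k \<le> card (set a)}"
  have interpolate: "\<exists>g. (n, g) \<in> F \<and> (\<forall>a\<in>tuples A n. card (set a) < k \<longrightarrow> g a = f' a) \<and> (\<forall>a\<in>S. g a = f a)"
    if "finite S" "S \<subseteq> H" for S
    using that
  proof (induction S rule: finite_psubset_induct)
    case (psubset S)
    have IH: "\<exists>g. (n, g) \<in> F \<and> (\<forall>a\<in>tuples A n. card (set a) < k \<longrightarrow> g a = f' a) \<and> (\<forall>a\<in>S - {x}. g a = f a)"
      if "x \<in> S" for x
      using psubset.IH[of "S - {x}"] psubset.prems that by blast
    consider "S = {}" | x where "S = {x}" | x y where "x \<in> S" "y \<in> S" "x \<noteq> y" by auto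
    then show ?case
    proof cases
      case 1
      then show ?thesis using f' by blast
    next
      case 2
      then have x: "x \<in> tuples A n" "k \<le> card (set x)" using psubset.prems by (auto simp: H_def)
      show ?thesis
        using F.adjust_value[OF semi x f' G.value_in_set[OF f x(1)]] 2 by auto
    next
      case 3
      then have x: "x \<in> tuples A n" "k \<le> card (set x)" and y: "y \<in> tuples A n" "k \<le> card (set y)"
        using psubset.prems by (auto simp: H_def)
      obtain u where u: "(n, u) \<in> F" "\<And>a. a \<in> tuples A n \<Longrightarrow> card (set a) < k \<Longrightarrow> u a = f' a"
          "\<And>a. a \<in> S \<Longrightarrow> a \<noteq> x \<Longrightarrow> u a = f a"
        using IH[OF 3(1)] by auto
      obtain v where v: "(n, v) \<in> F" "\<And>a. a \<in> tuples A n \<Longrightarrow> card (set a) < k \<Longrightarrow> v a = f' a"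
          "\<And>a. a \<in> S \<Longrightarrow> a \<noteq> y \<Longrightarrow> v a = f a"
        using IH[OF 3(2)] by auto
      show ?thesis
      proof (cases "u x = f x")
        case True
        then show ?thesis using u by metis
      next
        case False
        \<comment> \<open>\<open>u\<close> matches \<open>f\<close> at \<open>y\<close> but not at
          \<open>x\<close>, which R would forbid for related tuples.\<close>
        have "(y, x) \<notin> Rrel A F"
          using related_agree_iff[OF _ y(1) u(1) f] u(3)[of y] 3 False by metis
        obtain z where z: "z \<in> set x" "z \<noteq> u x" "z \<noteq> f x"
          using third_element[of "set x" "u x" "f x"] x(2) semi(2) by auto
        \<comment> \<open>At \<open>y\<close> the member \<open>w\<close> agrees with
          \<open>u\<close>, which protects the value there; at \<open>x\<close> it takes a third
          value, so that \<open>collapse\<close> applies. At the other tuples of \<open>S\<close>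
          the members \<open>u\<close> and \<open>v\<close> agree already.\<close>
        obtain w where w: "(n, w) \<in> F" "w y = f y" "w x = z"
          using F.adjust_two_values[OF semi y x \<open>(y, x) \<notin> Rrel A F\<close> f' G.value_in_set[OF f y(1)] z(1)] by blast
        have "v x = f x" using v(3) 3 by blast
        then have "distinct [u x, v x, w x]" using False z w by auto
        from F.collapse[OF semi x u(1) v(1) w(1) this]
        obtain h where h: "(n, h) \<in> F" "h x = v x" "\<And>b. b \<in> tuples A n \<Longrightarrow>
            card (set b) < k \<or> u b = v b \<or> u b = w b \<or> v b = w b \<Longrightarrow> h b = u b"
          by blast
        have "h a = f a" if "a \<in> S" for a
        proof -
          consider "a = x" | "a = y" | "a \<noteq> x" "a \<noteq> y" by blast
          then show ?thesis
          proof cases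
            case 1
            then show ?thesis using h(2) \<open>v x = f x\<close> by simp
          next
            case 2
            then show ?thesis using h(3)[OF y(1)] w(2) u(3) 3 by metis
          next
            case 3
            have "a \<in> tuples A n" using that psubset.prems by (auto simp: H_def)
            then show ?thesis using h(3)[of a] u(3) v(3) 3 that by simp
          qed
        qed
        then show ?thesis using h u(2) by metis
      qed
    qed
  qed
  have "finite H" using F.finite_tuples by (simp add: H_def)
  from interpolate[OF this] obtain g where g: "(n, g) \<in> F"
      "\<And>a. a \<in> tuples A n \<Longrightarrow> card (set a) < k \<Longrightarrow> g a = f' a" "\<And>a. a \<in> H \<Longrightarrow> g a = f a"
    by blast
  have "g = f"
  proof (rule op_eqI[OF F.in_ops[OF g(1)] G.in_ops[OF f]])
    show "g a = f a" if "a \<in> tuples A n" for a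
      using g(2,3) low that by (cases "card (set a) < k") (auto simp: H_def)
  qed
  then show ?thesis using g(1) by simp
qed

end

subsection \<open>Majority operations\<close>

definition binary_trivial :: "'a set \<Rightarrow> 'a op set \<Rightarrow> bool" where
  "binary_trivial A F \<longleftrightarrow> (\<forall>t. (2, t) \<in> F \<longrightarrow>
     (\<forall>x\<in>A. \<forall>y\<in>A. t [x, y] = x) \<or> (\<forall>x\<in>A. \<forall>y\<in>A. t [x, y] = y))"

context conservative_symmetric_clone
begin

definition majority :: "('a list \<Rightarrow> 'a) \<Rightarrow> bool" where
  "majority m \<longleftrightarrow> (3, m) \<in> F \<and> (\<forall>x\<in>A. \<forall>y\<in>A. m [x, x, y] = x \<and> m [x, y, x] = x \<and> m [y, x, x] = x)"

text \<open>For fixed \<open>a\<close> and \<open>b\<close> this is the set of value pairs, read as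
  a relation with rows indexed by entries of \<open>a\<close> and columns by entries of
  \<open>b\<close>. The arity comes from \<open>a\<close>.\<close>

definition joint :: "'a list \<Rightarrow> 'a list \<Rightarrow> 'a \<Rightarrow> 'a \<Rightarrow> bool" where
  "joint a b c d \<longleftrightarrow> (\<exists>u. (length a, u) \<in> F \<and> u a = c \<and> u b = d)"

lemma conjugate_ternary:
  assumes "(3, m) \<in> F" "distinct xs" "distinct ys" "length xs = length ys" "set xs \<subseteq> A" "set ys \<subseteq> A"
  shows "\<exists>\<sigma> m'. bij_betw \<sigma> A A \<and> map \<sigma> xs = ys \<and> (3, m') \<in> F \<and>
    (\<forall>x\<in>A. \<forall>y\<in>A. \<forall>z\<in>A. \<sigma> (m' [x, y, z]) = m [\<sigma> x, \<sigma> y, \<sigma> z] \<and> m' [x, y, z] \<in> {x, y, z})"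
proof -
  obtain \<sigma> where \<sigma>: "bij_betw \<sigma> A A" "map \<sigma> xs = ys"
    using extend_lists_to_permutation[OF fin assms(2-6)] by blast
  obtain m' where m': "(3, m') \<in> F" "\<And>x. x \<in> tuples A 3 \<Longrightarrow> \<sigma> (m' x) = m (map \<sigma> x)"
    using conjugate[OF \<sigma>(1) assms(1)] by blast
  have "[x, y, z] \<in> tuples A 3" if "x \<in> A" "y \<in> A" "z \<in> A" for x y z
    using that by (simp add: tuples_def)
  then have "\<forall>x\<in>A. \<forall>y\<in>A. \<forall>z\<in>A. \<sigma> (m' [x, y, z]) = m [\<sigma> x, \<sigma> y, \<sigma> z] \<and> m' [x, y, z] \<in> {x, y, z}"
    using m'(2) value_in_set[OF m'(1)] by fastforce
  then show ?thesis using \<sigma> m'(1) by blast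
qed

lemma conjugate_majority:
  assumes "majority m" "distinct xs" "distinct ys" "length xs = length ys" "set xs \<subseteq> A" "set ys \<subseteq> A"
  shows "\<exists>\<sigma> m'. bij_betw \<sigma> A A \<and> map \<sigma> xs = ys \<and> majority m' \<and>
    (\<forall>x\<in>A. \<forall>y\<in>A. \<forall>z\<in>A. \<sigma> (m' [x, y, z]) = m [\<sigma> x, \<sigma> y, \<sigma> z])"
proof -
  have m: "(3, m) \<in> F" using assms(1) by (simp add: majority_def)
  obtain \<sigma> m' where \<sigma>: "bij_betw \<sigma> A A" "map \<sigma> xs = ys" and m': "(3, m') \<in> F"
    "\<forall>x\<in>A. \<forall>y\<in>A. \<forall>z\<in>A. \<sigma> (m' [x, y, z]) = m [\<sigma> x, \<sigma> y, \<sigma> z] \<and> m' [x, y, z] \<in> {x, y, z}"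
    using conjugate_ternary[OF m assms(2-6)] by blast
  have cancel: "c = d" if "\<sigma> c = \<sigma> d" "c \<in> A" "d \<in> A" for c d
    using that \<sigma>(1) by (auto simp: bij_betw_def inj_on_def)
  have "\<sigma> x \<in> A" if "x \<in> A" for x using that \<sigma>(1) by (auto simp: bij_betw_def)
  then have "majority m'"
    using assms(1) m' cancel unfolding majority_def by (metis insertE singletonD)
  then show ?thesis using \<sigma> m'(2) by blast
qed

text \<open>If \<open>c'\<close> and \<open>c''\<close> differed, a majority operation applied to
  members with value pairs \<open>(c, d')\<close>, \<open>(c', d)\<close>, \<open>(c'', d)\<close>
  would give \<open>d\<close> at \<open>b\<close>. At \<open>a\<close> its arguments are distinct,
  and a conjugate with the arguments suitably arranged returns \<open>c\<close>, producing the
  missing pair.\<close>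

lemma joint_partner_unique:
  assumes "majority m" and ab: "a \<in> tuples A n" "b \<in> tuples A n"
    and "\<not> joint a b c d" "joint a b c d'" "joint a b c' d" "joint a b c'' d"
  shows "c' = c''"
proof (rule ccontr)
  assume ne: "c' \<noteq> c''"
  have len: "length a = n" using ab by (simp add: tuples_def)
  obtain u v w where u: "(n, u) \<in> F" "u a = c" "u b = d'" and v: "(n, v) \<in> F" "v a = c'" "v b = d"
    and w: "(n, w) \<in> F" "w a = c''" "w b = d"
    using assms(5-7) by (auto simp: joint_def len)
  have dist: "distinct [c, c', c'']" using ne assms by auto
  have A: "c \<in> A" "c' \<in> A" "c'' \<in> A" "d \<in> A" "d' \<in> A"
    using value_in_carrier u v w ab by blast+
  have no: "m' [p a, q a, r a] \<noteq> c"
    if "majority m'" "(n, p) \<in> F" "(n, q) \<in> F" "(n, r) \<in> F" "m' [p b, q b, r b] = d" for m' p q r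
    using composition3[of m' n p q r] that assms(4) ab by (auto simp: joint_def majority_def len)
  have "m [c, c', c''] \<in> {c, c', c''}"
    using value_in_set[of 3 m "[c, c', c'']"] assms(1) A by (auto simp: majority_def tuples_def)
  moreover have "m [c, c', c''] \<noteq> c"
    using no[OF assms(1) u(1) v(1) w(1)] assms(1) u v w A by (auto simp: majority_def)
  moreover have "m [c, c', c''] \<noteq> c'"
  proof
    assume eq: "m [c, c', c''] = c'"
    \<comment> \<open>Since \<open>m\<close> returns its middle argument at
      \<open>[c, c', c'']\<close>, the conjugate returns its middle argument, now \<open>c\<close>,
      at \<open>[c', c, c'']\<close>.\<close>
    obtain \<sigma> m' where \<sigma>: "bij_betw \<sigma> A A" "map \<sigma> [c, c', c''] = [c', c, c'']" and m': "majority m'"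
      "\<forall>x\<in>A. \<forall>y\<in>A. \<forall>z\<in>A. \<sigma> (m' [x, y, z]) = m [\<sigma> x, \<sigma> y, \<sigma> z]"
      using conjugate_majority[OF assms(1), of "[c, c', c'']" "[c', c, c'']"] dist A by auto
    have "\<sigma> (m' [c', c, c'']) = \<sigma> c" using m'(2) A \<sigma>(2) eq by auto
    moreover have "m' [c', c, c''] \<in> A"
      using value_in_carrier[of 3 m' "[c', c, c'']"] m'(1) A by (auto simp: majority_def tuples_def)
    ultimately have "m' [c', c, c''] = c"
      using \<sigma>(1) A by (auto simp: bij_betw_def inj_on_def)
    then show False using no[OF m'(1) v(1) u(1) w(1)] m'(1) u v w A by (auto simp: majority_def)
  qed
  moreover have "m [c, c', c''] \<noteq> c''"
  proof
    assume eq: "m [c, c', c''] = c''"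
    obtain \<sigma> m' where \<sigma>: "bij_betw \<sigma> A A" "map \<sigma> [c, c', c''] = [c'', c', c]" and m': "majority m'"
      "\<forall>x\<in>A. \<forall>y\<in>A. \<forall>z\<in>A. \<sigma> (m' [x, y, z]) = m [\<sigma> x, \<sigma> y, \<sigma> z]"
      using conjugate_majority[OF assms(1), of "[c, c', c'']" "[c'', c', c]"] dist A by auto
    have "\<sigma> (m' [c'', c', c]) = \<sigma> c" using m'(2) A \<sigma>(2) eq by auto
    moreover have "m' [c'', c', c] \<in> A"
      using value_in_carrier[of 3 m' "[c'', c', c]"] m'(1) A by (auto simp: majority_def tuples_def)
    ultimately have "m' [c'', c', c] = c"
      using \<sigma>(1) A by (auto simp: bij_betw_def inj_on_def)
    then show False using no[OF m'(1) w(1) v(1) u(1)] m'(1) u v w A by (auto simp: majority_def)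
  qed
  ultimately show False by blast
qed

end

context clone_pair
begin

text \<open>By \<open>joint_partner_unique\<close> a row or column with two value pairs is full.
  Were the pair of \<open>f\<close> missing, R would exclude the graph of a bijection, leaving a
  cross, which D and the triviality of binary members exclude.\<close>

lemma majority_two_values:
  assumes m: "F.majority m" and D: "Drel A F = Drel A G" and triv: "binary_trivial A F"
    and f: "(n, f) \<in> G" and ab: "a \<in> tuples A n" "b \<in> tuples A n"
  shows "F.joint a b (f a) (f b)"
proof -
  have len: "length a = n" "length b = n" using ab by (auto simp: tuples_def)
  have swap: "F.joint b a y x \<longleftrightarrow> F.joint a b x y" for x y by (auto simp: F.joint_def len)
  note unique_fst = F.joint_partner_unique[OF m ab]
  note unique_snd = F.joint_partner_unique[OF m ab(2,1), unfolded swap]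
  have row: "\<exists>y. F.joint a b x y" if "x \<in> set a" for x
    using F.value_attained[OF ab(1) that] by (auto simp: F.joint_def len)
  have col: "\<exists>x. F.joint a b x y" if "y \<in> set b" for y
    using F.value_attained[OF ab(2) that] by (auto simp: F.joint_def len)
  have joint_in: "x \<in> set a" "y \<in> set b" if "F.joint a b x y" for x y
    using that F.value_in_set ab by (auto simp: F.joint_def len)
  show ?thesis
  proof (rule ccontr)
    assume missing: "\<not> ?thesis"
    define c d where "c = f a" and "d = f b"
    have c: "c \<in> set a" and d: "d \<in> set b" using G.value_in_set f ab by (auto simp: c_def d_def)
    have ncd: "\<not> F.joint a b c d" using missing by (simp add: c_def d_def)
    have "(a, b) \<notin> Rrel A F"
    proof
      assume R: "(a, b) \<in> Rrel A F"
      obtain u where "(n, u) \<in> F" "u a = c" using F.value_attained[OF ab(1) c] by blast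
      then show False
        using related_agree_iff[OF R ab(1) _ f, of u] ncd unfolding F.joint_def len c_def d_def by metis
    qed
    then obtain u v where uv: "(n, u) \<in> F" "(n, v) \<in> F" "u a = v a \<longleftrightarrow> u b \<noteq> v b"
      using F.related_if_same_kernel[OF ab] by blast
    obtain d0 where d0: "F.joint a b c d0" using row c by blast
    obtain c0 where c0: "F.joint a b c0 d" using col d by blast
    have full_row: "F.joint a b x y"
      if "F.joint a b x y1" "F.joint a b x y2" "y1 \<noteq> y2" "y \<in> set b" for x y y1 y2
      using unique_snd[OF _ _ that(1,2)] col[OF that(4)] that(3) by blast
    have full_col: "F.joint a b x y"
      if "F.joint a b x1 y" "F.joint a b x2 y" "x1 \<noteq> x2" "x \<in> set a" for x y x1 x2
      using unique_fst[OF _ _ that(1,2)] row[OF that(4)] that(3) by blast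
    have "c \<noteq> c0" "d \<noteq> d0" using ncd c0 d0 by auto
    \<comment> \<open>The separating pair \<open>u\<close>, \<open>v\<close> gives a full row or a
      full column. A full row meets column \<open>d\<close>, whose only partner is
      \<open>c0\<close>, so it is row \<open>c0\<close> and contains \<open>d0\<close>; columns are
      symmetric.\<close>
    have "F.joint a b c0 d0"
    proof (cases "u a = v a")
      case True
      have "F.joint a b (u a) y" if "y \<in> set b" for y
        using full_row[of "u a" "u b" "v b" y] uv True that by (auto simp: F.joint_def len)
      then have "F.joint a b (u a) d" "F.joint a b (u a) d0" using d joint_in(2)[OF d0] by blast+
      then show ?thesis using unique_fst[OF ncd d0 c0] by blast
    next
      case False
      have "F.joint a b x (u b)" if "x \<in> set a" for x
        using full_col[of "u a" "u b" "v a" x] uv False that by (auto simp: F.joint_def len)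
      then have "F.joint a b c (u b)" "F.joint a b c0 (u b)" using c joint_in(1)[OF c0] by blast+
      then show ?thesis using unique_snd[OF ncd c0 d0] by blast
    qed
    \<comment> \<open>The value pairs at \<open>a\<close>, \<open>b\<close> form a cross with centre \<open>(c0, d0)\<close>; the relation \<open>D\<close> confines
      \<open>G\<close> to a cross as well, whose centre \<open>(c1, d1)\<close> must be different. Then the entries of \<open>a\<close> and
      \<open>b\<close> are linked by a bijection, which binary members, being projections, cannot break.\<close>
    have cross: "x = c0 \<or> y = d0" if xy: "F.joint a b x y" for x y
    proof (rule ccontr)
      assume "\<not> ?thesis"
      then have ne: "x \<noteq> c0" "y \<noteq> d0" by auto
      have "F.joint a b c y"
        using full_col[OF xy full_row[OF c0 \<open>F.joint a b c0 d0\<close> \<open>d \<noteq> d0\<close> joint_in(2)[OF xy]] ne(1) c] .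
      then show False using unique_snd[OF ncd c0 d0] ne by blast
    qed
    have "c0 \<in> A" "d0 \<in> A" using joint_in[OF \<open>F.joint a b c0 d0\<close>] ab by (auto simp: tuples_def)
    then have "(a, b) \<in> Drel A F"
      using ab cross unfolding Drel_def F.joint_def len by blast
    then have "(a, b) \<in> Drel A G" using D by simp
    then obtain c1 d1 where G_cross: "\<And>g. (n, g) \<in> G \<Longrightarrow> g a = c1 \<or> g b = d1"
      unfolding Drel_def using ab by (auto simp: tuples_def)
    have entries: "(a ! i = c0 \<or> b ! i = d0) \<and> (a ! i = c1 \<or> b ! i = d1)" if i: "i < n" for i
    proof -
      obtain p where p: "(n, p) \<in> F" "p a = a ! i" "p b = b ! i" using F.projection[OF i] ab by blast
      then have "F.joint a b (a ! i) (b ! i)" by (auto simp: F.joint_def len)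
      moreover obtain q where "(n, q) \<in> G" "q a = a ! i" "q b = b ! i" using G.projection[OF i] ab by blast
      ultimately show ?thesis using cross G_cross by metis
    qed
    have cd1: "c = c1 \<or> d = d1" using G_cross[OF f] by (simp add: c_def d_def)
    \<comment> \<open>If the centres shared \<open>c0\<close>, then \<open>d1\<close> would be
      \<open>d\<close>, and the two crosses would force every entry of \<open>a\<close> to be
      \<open>c0\<close>, although \<open>c\<close> is an entry.\<close>
    have "c1 \<noteq> c0"
    proof
      assume "c1 = c0"
      then have "d = d1" using cd1 \<open>c \<noteq> c0\<close> by simp
      then have "a ! i = c0" if "i < n" for i
        using entries[OF that] \<open>c1 = c0\<close> \<open>d \<noteq> d0\<close> by auto
      then show False using c \<open>c \<noteq> c0\<close> len by (metis in_set_conv_nth)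
    qed
    have "d1 \<noteq> d0"
    proof
      assume "d1 = d0"
      then have "b ! i = d0" if "i < n" for i
        using entries[OF that] \<open>c1 \<noteq> c0\<close> by auto
      then show False using d \<open>d \<noteq> d0\<close> len by (metis in_set_conv_nth)
    qed
    have entries': "a ! i = c0 \<and> b ! i = d1 \<or> a ! i = c1 \<and> b ! i = d0" if "i < n" for i
      using entries[OF that] \<open>c1 \<noteq> c0\<close> \<open>d1 \<noteq> d0\<close> by auto
    \<comment> \<open>\<open>a\<close> and \<open>b\<close> are two-valued with a common pattern. A
      member with values \<open>(c0, d0)\<close> therefore has a binary minor choosing first at
      \<open>[c0, c1]\<close> and second at \<open>[d1, d0]\<close>.\<close>
    define bs where "bs = map (\<lambda>x. x = c0) a"
    have ab_eq: "a = map (\<lambda>e. if e then c0 else c1) bs" "b = map (\<lambda>e. if e then d1 else d0) bs"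
      using \<open>c1 \<noteq> c0\<close> by (auto simp: bs_def len intro!: nth_equalityI dest: entries')
    obtain w where w: "(n, w) \<in> F" "w a = c0" "w b = d0"
      using \<open>F.joint a b c0 d0\<close> by (auto simp: F.joint_def len)
    obtain t where t: "(2, t) \<in> F"
        "\<forall>x\<in>A. \<forall>y\<in>A. t [x, y] = w (map (\<lambda>e. if e then x else y) bs)"
      using F.binary_minor[OF w(1), of bs] len by (auto simp: bs_def)
    have "c1 \<in> set a" using c \<open>c \<noteq> c0\<close> entries' len by (metis in_set_conv_nth)
    moreover have "d1 \<in> set b" using d \<open>d \<noteq> d0\<close> entries' len by (metis in_set_conv_nth)
    ultimately have "c1 \<in> A" "d1 \<in> A" using ab by (auto simp: tuples_def)
    then have "t [c0, c1] = c0" "t [d1, d0] = d0"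
      using t(2) w ab_eq \<open>c0 \<in> A\<close> \<open>d0 \<in> A\<close> by metis+
    then show False
      using triv t(1) \<open>c0 \<in> A\<close> \<open>d0 \<in> A\<close> \<open>c1 \<in> A\<close> \<open>d1 \<in> A\<close> \<open>c1 \<noteq> c0\<close> \<open>d1 \<noteq> d0\<close>
      unfolding binary_trivial_def by metis
  qed
qed

text \<open>Baker--Pixley argument: of three interpolants, each possibly wrong at a different tuple,
  at least two are right at every tuple of \<open>S\<close>, so their majority is right
  throughout.\<close>

lemma member_if_majority:
  assumes m: "F.majority m" and D: "Drel A F = Drel A G" and triv: "binary_trivial A F"
    and f: "(n, f) \<in> G"
  shows "(n, f) \<in> F"
proof -
  \<comment> \<open>Conservativity excludes nullary members; so a projection is available to start
    from.\<close>
  have "n > 0" using G.value_in_set[OF f, of "[]"] by (cases n) (auto simp: tuples_def)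
  have interpolate: "\<exists>g. (n, g) \<in> F \<and> (\<forall>a\<in>S. g a = f a)" if "finite S" "S \<subseteq> tuples A n" for S
    using that
  proof (induction S rule: finite_psubset_induct)
    case (psubset S)
    have IH: "\<exists>g. (n, g) \<in> F \<and> (\<forall>a\<in>S - {x}. g a = f a)" if "x \<in> S" for x
      using psubset.IH[of "S - {x}"] psubset.prems that by blast
    \<comment> \<open>In the second case \<open>x\<close> and \<open>y\<close> may coincide, which
      covers singletons.\<close>
    consider "S = {}" | x y where "x \<in> S" "y \<in> S" "S \<subseteq> {x, y}"
      | x y z where "x \<in> S" "y \<in> S" "z \<in> S" "x \<noteq> y" "x \<noteq> z" "y \<noteq> z" by blast
    then show ?case
    proof cases
      case 1
      then show ?thesis using F.projection[OF \<open>n > 0\<close>] by blast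
    next
      case 2
      then have xy: "x \<in> tuples A n" "y \<in> tuples A n" using psubset.prems by auto
      then have "length x = n" by (simp add: tuples_def)
      then show ?thesis
        using majority_two_values[OF m D triv f xy] 2(3) unfolding F.joint_def by blast
    next
      case 3
      obtain u where u: "(n, u) \<in> F" "\<And>a. a \<in> S \<Longrightarrow> a \<noteq> x \<Longrightarrow> u a = f a" using IH[OF 3(1)] by auto
      obtain v where v: "(n, v) \<in> F" "\<And>a. a \<in> S \<Longrightarrow> a \<noteq> y \<Longrightarrow> v a = f a" using IH[OF 3(2)] by auto
      obtain w where w: "(n, w) \<in> F" "\<And>a. a \<in> S \<Longrightarrow> a \<noteq> z \<Longrightarrow> w a = f a" using IH[OF 3(3)] by auto
      obtain h where h: "(n, h) \<in> F" "\<And>a. a \<in> tuples A n \<Longrightarrow> h a = m [u a, v a, w a]"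
        using F.composition3[OF _ u(1) v(1) w(1)] m unfolding F.majority_def by blast
      have "h a = f a" if a: "a \<in> S" for a
      proof -
        have a': "a \<in> tuples A n" using a psubset.prems by blast
        have "u a \<in> A" "v a \<in> A" "w a \<in> A" using F.value_in_carrier a' u v w by blast+
        moreover have "(u a = f a \<and> v a = f a) \<or> (u a = f a \<and> w a = f a) \<or> (v a = f a \<and> w a = f a)"
          using u(2) v(2) w(2) 3 a by metis
        ultimately show ?thesis using h(2)[OF a'] m unfolding F.majority_def by metis
      qed
      then show ?thesis using h(1) by blast
    qed
  qed
  obtain g where g: "(n, g) \<in> F" "\<And>a. a \<in> tuples A n \<Longrightarrow> g a = f a"
    using interpolate[OF F.finite_tuples] by blast
  have "g = f" using op_eqI[OF F.in_ops[OF g(1)] G.in_ops[OF f]] g(2) by blast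
  then show ?thesis using g(1) by simp
qed

end

subsection \<open>Binary operations\<close>

context conservative_symmetric_clone
begin

text \<open>A preorder on ordered pairs. By \<open>forces_sym\<close> it is an equivalence on pairs
  of distinct elements of \<open>A\<close>, whose classes are the sets of pairs on which all binary
  members make the same choice of place.\<close>

definition forces :: "'a \<Rightarrow> 'a \<Rightarrow> 'a \<Rightarrow> 'a \<Rightarrow> bool" where
  "forces p q p' q' \<longleftrightarrow> (\<forall>t. (2, t) \<in> F \<longrightarrow> t [p, q] = q \<longrightarrow> t [p', q'] = q')"

lemma forces_trans: "forces p q x y \<Longrightarrow> forces x y v w \<Longrightarrow> forces p q v w"
  by (simp add: forces_def)

lemma pair_in_tuples: "[x, y] \<in> tuples A 2 \<longleftrightarrow> x \<in> A \<and> y \<in> A"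
  by (simp add: tuples_def)

lemma binary_value: "(2, t) \<in> F \<Longrightarrow> x \<in> A \<Longrightarrow> y \<in> A \<Longrightarrow> t [x, y] = x \<or> t [x, y] = y"
  using value_in_set[of 2 t "[x, y]"] by (auto simp: pair_in_tuples)

lemma conjugate_binary:
  assumes "bij_betw \<sigma> A A" "(2, t) \<in> F"
  shows "\<exists>h. (2, h) \<in> F \<and> (\<forall>x\<in>A. \<forall>y\<in>A. h [x, y] = y \<longleftrightarrow> t [\<sigma> x, \<sigma> y] = \<sigma> y)"
proof -
  obtain h where h: "(2, h) \<in> F" "\<And>x. x \<in> tuples A 2 \<Longrightarrow> \<sigma> (h x) = t (map \<sigma> x)"
    using conjugate[OF assms] by blast
  have "h [x, y] = y \<longleftrightarrow> t [\<sigma> x, \<sigma> y] = \<sigma> y" if "x \<in> A" "y \<in> A" for x y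
  proof -
    have "[x, y] \<in> tuples A 2" using that by (simp add: pair_in_tuples)
    then have "h [x, y] \<in> A" "t [\<sigma> x, \<sigma> y] = \<sigma> (h [x, y])"
      using value_in_carrier[OF h(1)] h(2) by auto
    then show ?thesis using inj_on_eq_iff[OF bij_betw_imp_inj_on[OF assms(1)]] that(2) by simp
  qed
  then show ?thesis using h(1) by blast
qed

lemma forces_image:
  assumes "bij_betw \<sigma> A A" "forces p q p' q'" "p \<in> A" "q \<in> A" "p' \<in> A" "q' \<in> A"
  shows "forces (\<sigma> p) (\<sigma> q) (\<sigma> p') (\<sigma> q')"
  using conjugate_binary[OF assms(1)] assms(2-) unfolding forces_def by metis

text \<open>
  By conjugation, the members that choose the second argument at \<open>(p, q)\<close> are as many as those that
  do so at \<open>(p', q')\<close>, hence an inclusion between these finite sets is an equality.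
\<close>
lemma forces_sym:
  assumes "forces p q p' q'" "p \<noteq> q" "p' \<noteq> q'" "p \<in> A" "q \<in> A" "p' \<in> A" "q' \<in> A"
  shows "forces p' q' p q"
proof -
  define T where "T x y = {t. (2, t) \<in> F \<and> t [x, y] = y}" for x y
  have finite: "finite (T x y)" for x y
    by (rule finite_subset[OF _ finite_members[of 2]]) (auto simp: T_def)
  obtain \<sigma> where \<sigma>: "bij_betw \<sigma> A A" "\<sigma> p = p'" "\<sigma> q = q'"
    using extend_lists_to_permutation[OF fin, of "[p, q]" "[p', q']"] assms by auto
  \<comment> \<open>\<open>\<phi>\<close> is conjugation by \<open>\<sigma>\<close>. It is
    injective, since every pair is the image of a pair under \<open>\<sigma>\<close>.\<close>
  have "\<forall>t. \<exists>h. (2, t) \<in> F \<longrightarrow> (2, h) \<in> F \<and> (\<forall>x\<in>tuples A 2. \<sigma> (h x) = t (map \<sigma> x))"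
    using conjugate[OF \<sigma>(1)] by blast
  then obtain \<phi> where \<phi>: "\<And>t. (2, t) \<in> F \<Longrightarrow> (2, \<phi> t) \<in> F"
      "\<And>t x. (2, t) \<in> F \<Longrightarrow> x \<in> tuples A 2 \<Longrightarrow> \<sigma> (\<phi> t x) = t (map \<sigma> x)"
    by metis
  have "inj_on \<phi> (T p' q')"
  proof (rule inj_onI)
    fix t1 t2 assume t: "t1 \<in> T p' q'" "t2 \<in> T p' q'" "\<phi> t1 = \<phi> t2"
    then have F: "(2, t1) \<in> F" "(2, t2) \<in> F" by (auto simp: T_def)
    show "t1 = t2"
    proof (rule op_eqI[OF in_ops[OF F(1)] in_ops[OF F(2)]])
      fix y assume y: "y \<in> tuples A 2"
      let ?x = "map (inv_into A \<sigma>) y"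
      have "?x \<in> tuples A 2"
        using y bij_betw_inv_into[OF \<sigma>(1)] by (auto simp: tuples_def bij_betw_def)
      moreover have "map \<sigma> ?x = y"
        using y bij_betw_inv_into_right[OF \<sigma>(1)] by (auto simp: tuples_def subset_iff intro!: map_idI)
      ultimately show "t1 y = t2 y" using \<phi>(2)[OF F(1)] \<phi>(2)[OF F(2)] t(3) by metis
    qed
  qed
  moreover have "\<phi> ` T p' q' \<subseteq> T p q"
  proof clarify
    fix t assume "t \<in> T p' q'"
    then have t: "(2, t) \<in> F" "t [p', q'] = q'" by (auto simp: T_def)
    have "\<sigma> (\<phi> t [p, q]) = \<sigma> q"
      using \<phi>(2)[OF t(1), of "[p, q]"] assms t(2) \<sigma> by (simp add: pair_in_tuples)
    moreover have "\<phi> t [p, q] \<in> A" using value_in_carrier[OF \<phi>(1)[OF t(1)]] assms by (simp add: pair_in_tuples)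
    ultimately have "\<phi> t [p, q] = q" using \<sigma>(1) assms by (auto simp: bij_betw_def inj_on_def)
    then show "\<phi> t \<in> T p q" using \<phi>(1)[OF t(1)] by (simp add: T_def)
  qed
  ultimately have "card (T p' q') \<le> card (T p q)" using finite by (metis card_inj_on_le)
  moreover have "T p q \<subseteq> T p' q'" using assms(1) by (auto simp: T_def forces_def)
  ultimately have "T p q = T p' q'" using finite by (metis card_seteq)
  then show ?thesis by (auto simp: T_def forces_def)
qed

text \<open>Contraposition, applied to the member with its arguments exchanged.\<close>

lemma forces_reverse:
  assumes "forces p q p' q'" "p' \<noteq> q'" "p \<in> A" "q \<in> A" "p' \<in> A" "q' \<in> A"
  shows "forces q' p' q p"
  unfolding forces_def
proof (intro allI impI)
  fix t assume t: "(2, t) \<in> F" "t [q', p'] = p'"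
  obtain h where h: "(2, h) \<in> F" "\<And>x. x \<in> tuples A 2 \<Longrightarrow> h x = t (map ((!) x) [1, 0])"
    using minor[OF t(1), of "[1, 0]" 2] by auto
  then have "h [x, y] = t [y, x]" if "x \<in> A" "y \<in> A" for x y using that by (simp add: pair_in_tuples)
  then show "t [q, p] = p"
    using assms t binary_value[OF t(1), of q p] h(1) by (auto simp: forces_def)
qed

text \<open>By conjugation one such instance holds for all triples, and by reversal so does its
  mirror image. Then every pair forces every other, and each binary member is a projection.\<close>

lemma not_forces_common_first:
  assumes "\<not> binary_trivial A F" "distinct [p, q, z]" "p \<in> A" "q \<in> A" "z \<in> A"
  shows "\<not> forces p q p z"
proof
  assume forces: "forces p q p z"
  have first: "forces x y x w" if xyw: "distinct [x, y, w]" "x \<in> A" "y \<in> A" "w \<in> A" for x y w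
  proof -
    obtain \<sigma> where "bij_betw \<sigma> A A" "map \<sigma> [p, q, z] = [x, y, w]"
      using extend_lists_to_permutation[OF fin assms(2) xyw(1)] assms(3-) xyw(2-) by auto
    then show ?thesis using forces_image[OF _ forces] assms by fastforce
  qed
  have second: "forces y x w x" if "distinct [x, y, w]" "x \<in> A" "y \<in> A" "w \<in> A" for x y w
    using forces_reverse[OF first[of x w y]] that by auto
  have third: "\<exists>c\<in>A. c \<noteq> x \<and> c \<noteq> y" for x y
    using assms by (metis distinct_length_2_or_more)
  have all: "forces a b x y" if "a \<noteq> b" "x \<noteq> y" "a \<in> A" "b \<in> A" "x \<in> A" "y \<in> A" for a b x y
  proof -
    have refl: "forces v w v w" for v w by (simp add: forces_def)
    have first': "forces v w v w'" if "v \<noteq> w" "v \<noteq> w'" "v \<in> A" "w \<in> A" "w' \<in> A" for v w w'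
      using first[of v w w'] refl that by (cases "w = w'") auto
    have second': "forces v w v' w" if "v \<noteq> w" "v' \<noteq> w" "v \<in> A" "w \<in> A" "v' \<in> A" for v w v'
      using second[of w v v'] refl that by (cases "v = v'") auto
    \<comment> \<open>The chain \<open>(a, b)\<close>, \<open>(a, c)\<close>, \<open>(x, c)\<close>,
      \<open>(x, y)\<close> changes one coordinate at a time; \<open>c\<close> keeps its pairs
      nonconstant.\<close>
    obtain c where c: "c \<in> A" "c \<noteq> a" "c \<noteq> x" using third by blast
    have "forces a b a c" "forces a c x c" "forces x c x y"
      using first' second' c that by auto
    then show ?thesis using forces_trans by blast
  qed
  have "(\<forall>x\<in>A. \<forall>y\<in>A. t [x, y] = x) \<or> (\<forall>x\<in>A. \<forall>y\<in>A. t [x, y] = y)" if t: "(2, t) \<in> F" for t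
  proof (cases "\<exists>a\<in>A. \<exists>b\<in>A. a \<noteq> b \<and> t [a, b] = b")
    case True
    then have "t [x, y] = y" if "x \<in> A" "y \<in> A" for x y
      using all[of _ _ x y] t binary_value[OF t, of x y] that unfolding forces_def by metis
    then show ?thesis by blast
  next
    case False
    then show ?thesis using binary_value[OF t] by metis
  qed
  then show False using assms(1) by (auto simp: binary_trivial_def)
qed

lemma not_forces_common_second:
  assumes "\<not> binary_trivial A F" "distinct [p, q, z]" "p \<in> A" "q \<in> A" "z \<in> A"
  shows "\<not> forces p q z q"
proof
  assume "forces p q z q"
  then have "forces q z q p" using forces_reverse assms by auto
  then show False using not_forces_common_first[OF assms(1), of q z p] assms by auto
qed

text \<open>Choosing the second argument exactly on the class of \<open>(p, q)\<close> makes later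
  modifications local to that class. The member is built by excluding the unforced pairs one by
  one.\<close>

lemma forcing_selector:
  assumes "p \<noteq> q" "p \<in> A" "q \<in> A"
  shows "\<exists>d. (2, d) \<in> F \<and> (\<forall>x\<in>A. \<forall>y\<in>A. x \<noteq> y \<longrightarrow> d [x, y] = (if forces p q x y then y else x))"
proof -
  define N where "N = {(x, y). x \<in> A \<and> y \<in> A \<and> x \<noteq> y \<and> \<not> forces p q x y}"
  have fin_N: "finite N" by (rule finite_subset[of _ "A \<times> A"]) (auto simp: N_def fin)
  have "\<exists>d. (2, d) \<in> F \<and> d [p, q] = q \<and> (\<forall>(x, y)\<in>M. d [x, y] = x)" if "finite M" "M \<subseteq> N" for M
    using that
  proof (induction M rule: finite_induct)
    case empty
    then show ?case using projection[of 1 2] assms by (force simp: pair_in_tuples)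
  next
    case (insert e M)
    obtain x y where e: "e = (x, y)" by force
    then have xy: "x \<in> A" "y \<in> A" "x \<noteq> y" "\<not> forces p q x y" using insert.prems by (auto simp: N_def)
    obtain b where b: "(2, b) \<in> F" "b [p, q] = q" "b [x, y] = x"
      using xy binary_value unfolding forces_def by metis
    obtain d where d: "(2, d) \<in> F" "d [p, q] = q" "\<And>v w. (v, w) \<in> M \<Longrightarrow> d [v, w] = v"
      using insert by blast
    obtain fst' where pr: "(2, fst') \<in> F" "\<And>v. v \<in> tuples A 2 \<Longrightarrow> fst' v = v ! 0"
      using projection[of 0 2] by auto
    \<comment> \<open>\<open>b [x, d [x, y]]\<close> keeps every first choice of \<open>d\<close> by
      idempotence, and adds the first choice of \<open>b\<close> where \<open>d\<close> chooses
      second.\<close>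
    obtain h where h: "(2, h) \<in> F" "\<And>v. v \<in> tuples A 2 \<Longrightarrow> h v = b [fst' v, d v]"
      using composition2[OF b(1) pr(1) d(1)] by blast
    have h': "h [v, w] = b [v, d [v, w]]" if "v \<in> A" "w \<in> A" for v w
      using h(2)[of "[v, w]"] pr(2)[of "[v, w]"] that by (simp add: pair_in_tuples)
    have idem: "b [v, v] = v" if "v \<in> A" for v using binary_value[OF b(1)] that by blast
    have "h [p, q] = q" using h' assms b d by simp
    moreover have "h [x, y] = x" using h' xy binary_value[OF d(1), of x y] idem b by auto
    moreover have "h [v, w] = v" if "(v, w) \<in> M" for v w
      using h' d(3)[OF that] idem insert.prems that by (auto simp: N_def)
    ultimately show ?case using h(1) e by blast
  qed
  from this[OF fin_N] obtain d
    where d: "(2, d) \<in> F" "d [p, q] = q" "\<And>x y. (x, y) \<in> N \<Longrightarrow> d [x, y] = x"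
    by auto
  then show ?thesis
    by (intro exI[of _ d]) (auto simp: forces_def N_def)
qed

lemma ternary_composition:
  assumes "(2, t) \<in> F" "(3, u) \<in> F" "(3, v) \<in> F"
  shows "\<exists>h. (3, h) \<in> F \<and>
    (\<forall>x\<in>A. \<forall>y\<in>A. \<forall>z\<in>A. h [x, y, z] = t [u [x, y, z], v [x, y, z]])"
proof -
  obtain h where h: "(3, h) \<in> F" "\<And>x. x \<in> tuples A 3 \<Longrightarrow> h x = t [u x, v x]"
    using composition2[OF assms] by blast
  then have "\<forall>x\<in>A. \<forall>y\<in>A. \<forall>z\<in>A. h [x, y, z] = t [u [x, y, z], v [x, y, z]]"
    by (simp add: tuples_def)
  then show ?thesis using h(1) by blast
qed

lemma ternary_projections:
  obtains u v w where "(3, u) \<in> F" "(3, v) \<in> F" "(3, w) \<in> F"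
    "\<And>x y z. x \<in> A \<Longrightarrow> y \<in> A \<Longrightarrow> z \<in> A \<Longrightarrow> u [x, y, z] = x \<and> v [x, y, z] = y \<and> w [x, y, z] = z"
proof -
  obtain u v w where "(3, u) \<in> F" "(3, v) \<in> F" "(3, w) \<in> F"
    "\<forall>x\<in>tuples A 3. u x = x ! 0" "\<forall>x\<in>tuples A 3. v x = x ! 1" "\<forall>x\<in>tuples A 3. w x = x ! 2"
    using projection[of 0 3] projection[of 1 3] projection[of 2 3] by auto
  then show ?thesis by (intro that[of u v w]) (auto simp: tuples_def)
qed

lemma ternary_semiprojectionI:
  assumes "(3, s) \<in> F"
    and "\<And>x y. x \<in> A \<Longrightarrow> y \<in> A \<Longrightarrow> s [x, x, y] = x \<and> s [x, y, x] = x \<and> s [x, y, y] = x"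
    and "s [p, q, z] \<noteq> p" "p \<in> A" "q \<in> A" "z \<in> A"
  shows "semiprojection 3 s"
proof -
  have "s x = x ! 0" if x: "x \<in> tuples A 3" "\<not> distinct x" for x
  proof -
    obtain a b c where abc: "x = [a, b, c]" "a \<in> A" "b \<in> A" "c \<in> A"
      using x(1) by (auto simp: tuples_def numeral_3_eq_3 length_Suc_conv)
    then show ?thesis using assms(2) x(2) by auto
  qed
  moreover have "[p, q, z] \<in> tuples A 3" using assms by (simp add: tuples_def)
  ultimately show ?thesis
    unfolding semiprojection_def using assms(1,3) by (metis nth_Cons_0)
qed

lemma semiprojection_if_not_binary_trivial:
  assumes "\<not> binary_trivial A F" "3 \<le> card A"
  shows "\<exists>s. semiprojection 3 s"
proof -
  obtain B where "B \<subseteq> A" "card B = 3" using obtain_subset_with_card_n[OF assms(2)] by blast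
  then obtain p q z where A: "p \<in> A" "q \<in> A" "z \<in> A" and ne: "p \<noteq> q" "p \<noteq> z" "q \<noteq> z"
    by (auto simp: card_3_iff)
  obtain u v w where pr: "(3, u) \<in> F" "(3, v) \<in> F" "(3, w) \<in> F"
    "\<And>x y z. x \<in> A \<Longrightarrow> y \<in> A \<Longrightarrow> z \<in> A \<Longrightarrow> u [x, y, z] = x \<and> v [x, y, z] = y \<and> w [x, y, z] = z"
    using ternary_projections by blast
  \<comment> \<open>The composite \<open>d3 (x, d2 (d1 (x, z), y))\<close> leads from \<open>p\<close> to \<open>z\<close>, to \<open>q\<close>, and then accepts \<open>q\<close>.
    With only two distinct arguments, \<open>d3\<close> leaves \<open>x\<close> only at pairs where \<open>d1\<close> and \<open>d2\<close> do nothing.\<close>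
  obtain d1 where d1: "(2, d1) \<in> F"
      "\<And>x y. x \<in> A \<Longrightarrow> y \<in> A \<Longrightarrow> x \<noteq> y \<Longrightarrow> d1 [x, y] = (if forces p z x y then y else x)"
    using forcing_selector[of p z] A ne by blast
  obtain d2 where d2: "(2, d2) \<in> F"
      "\<And>x y. x \<in> A \<Longrightarrow> y \<in> A \<Longrightarrow> x \<noteq> y \<Longrightarrow> d2 [x, y] = (if forces z q x y then y else x)"
    using forcing_selector[of z q] A ne by blast
  obtain d3 where d3: "(2, d3) \<in> F"
      "\<And>x y. x \<in> A \<Longrightarrow> y \<in> A \<Longrightarrow> x \<noteq> y \<Longrightarrow> d3 [x, y] = (if forces p q x y then y else x)"
    using forcing_selector[of p q] A ne by blast
  have idem: "d1 [x, x] = x" "d2 [x, x] = x" "d3 [x, x] = x" if "x \<in> A" for x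
    using that binary_value d1(1) d2(1) d3(1) by blast+
  obtain h1 where h1: "(3, h1) \<in> F"
      "\<And>x y z. x \<in> A \<Longrightarrow> y \<in> A \<Longrightarrow> z \<in> A \<Longrightarrow> h1 [x, y, z] = d1 [x, z]"
    using ternary_composition[OF d1(1) pr(1,3)] pr(4) by metis
  obtain h2 where h2: "(3, h2) \<in> F"
      "\<And>x y z. x \<in> A \<Longrightarrow> y \<in> A \<Longrightarrow> z \<in> A \<Longrightarrow> h2 [x, y, z] = d2 [d1 [x, z], y]"
    using ternary_composition[OF d2(1) h1(1) pr(2)] pr(4) h1(2) by metis
  obtain s where s: "(3, s) \<in> F"
      "\<And>x y z. x \<in> A \<Longrightarrow> y \<in> A \<Longrightarrow> z \<in> A \<Longrightarrow> s [x, y, z] = d3 [x, d2 [d1 [x, z], y]]"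
    using ternary_composition[OF d3(1) pr(1) h2(1)] pr(4) h2(2) by metis
  \<comment> \<open>A pair forced by both would, by symmetry and transitivity, make
    \<open>(p, q)\<close> force \<open>(p, z)\<close>.\<close>
  have no1: "\<not> (forces p q x y \<and> forces p z x y)" if "x \<in> A" "y \<in> A" "x \<noteq> y" for x y
    using not_forces_common_first[OF assms(1), of p q z] forces_trans forces_sym A ne that
    by (metis distinct_length_2_or_more distinct_singleton)
  have no2: "\<not> (forces p q x y \<and> forces z q x y)" if "x \<in> A" "y \<in> A" "x \<noteq> y" for x y
    using not_forces_common_second[OF assms(1), of p q z] forces_trans forces_sym A ne that
    by (metis distinct_length_2_or_more distinct_singleton)
  have "s [x, x, y] = x \<and> s [x, y, x] = x \<and> s [x, y, y] = x" if "x \<in> A" "y \<in> A" for x y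
  proof (cases "x = y")
    case False
    then show ?thesis
      using that s(2) d1(2) d2(2) d3(2) idem no1[of x y] no2[of x y] by auto
  qed (use that s(2) idem in auto)
  moreover have "s [p, q, z] = q"
    using s(2) d1(2) d2(2) d3(2) A ne by (simp add: forces_def)
  ultimately show ?thesis using ternary_semiprojectionI[OF s(1), of p q z] A ne by auto
qed

end

section \<open>Agreement on all two-element subsets\<close>

lemma restr_eq_agree:
  assumes "restr F B = restr G B" "(n, f) \<in> G"
  shows "\<exists>g. (n, g) \<in> F \<and> (\<forall>a\<in>tuples B n. g a = f a)"
proof -
  have "(n, \<lambda>x. if x \<in> tuples B n then f x else undefined) \<in> restr G B"
    using assms(2) by (force simp: restr_def)
  then have "(n, \<lambda>x. if x \<in> tuples B n then f x else undefined) \<in> restr F B" using assms(1) by simp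
  then obtain g where "(n, g) \<in> F"
      "(\<lambda>x. if x \<in> tuples B n then f x else undefined) = (\<lambda>x. if x \<in> tuples B n then g x else undefined)"
    unfolding restr_def by auto
  then show ?thesis by metis
qed

context clone_pair
begin

text \<open>Writing the pattern of \<open>b\<close> with \<open>p\<close>, \<open>q\<close> in place
  of \<open>p'\<close>, \<open>q'\<close> gives a tuple \<open>a\<close> at which all members of
  \<open>F\<close> make the same choices. So \<open>a\<close> and \<open>b\<close> are related by R,
  which transports agreement.\<close>

lemma agreement_transfer:
  assumes pq: "F.forces p q p' q'" "p \<noteq> q" "p' \<noteq> q'" "p \<in> A" "q \<in> A" "p' \<in> A" "q' \<in> A"
    and fg: "(n, f) \<in> G" "(n, g) \<in> F" and agree: "\<forall>a\<in>tuples {p, q} n. f a = g a"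
    and b: "b \<in> tuples {p', q'} n"
  shows "f b = g b"
proof -
  define bs where "bs = map (\<lambda>x. x = p') b"
  define a where "a = map (\<lambda>e. if e then p else q) bs"
  have len: "length bs = n" using b by (simp add: bs_def tuples_def)
  have b_eq: "b = map (\<lambda>e. if e then p' else q') bs"
    using b by (auto simp: bs_def tuples_def intro!: map_idI[symmetric])
  have a: "a \<in> tuples {p, q} n" using len by (auto simp: a_def tuples_def)
  have aA: "a \<in> tuples A n" and bA: "b \<in> tuples A n"
    using a b pq by (auto simp: tuples_def)
  have iff: "u a = q \<longleftrightarrow> u b = q'" and vals: "u a = p \<or> u a = q" "u b = p' \<or> u b = q'"
    if u: "(n, u) \<in> F" for u
  proof -
    obtain t where "(2, t) \<in> F" "t [p, q] = u a" "t [p', q'] = u b"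
      using F.binary_minor[OF u len] pq b_eq a_def by metis
    then show "u a = q \<longleftrightarrow> u b = q'" "u a = p \<or> u a = q" "u b = p' \<or> u b = q'"
      using F.forces_sym[OF pq] pq(1) F.binary_value pq(4-) unfolding F.forces_def by metis+
  qed
  have "(a, b) \<in> Rrel A F"
    using F.related_if_same_kernel[OF aA bA] iff vals by metis
  then show ?thesis using related_agree_iff[OF _ aA fg(2,1)] agree a by blast
qed

lemma agree_on_small_tuples:
  assumes "\<And>p q. p \<in> A \<Longrightarrow> q \<in> A \<Longrightarrow> p \<noteq> q \<Longrightarrow> \<forall>a\<in>tuples {p, q} n. f a = g a"
    and "2 \<le> card A" "(n, f) \<in> G" "a \<in> tuples A n" "card (set a) < 3"
  shows "f a = g a"
proof -
  have "set a \<subseteq> A" using assms(4) by (simp add: tuples_def)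
  moreover have "card (set a) \<le> 2" using assms(5) by simp
  ultimately obtain B where B: "set a \<subseteq> B" "B \<subseteq> A" "card B = 2"
    using exists_subset_between[of "set a" 2 A] assms(2) F.fin by auto
  then obtain p q where "B = {p, q}" "p \<noteq> q" by (auto simp: card_2_iff)
  then show ?thesis using assms(1)[of p q] B assms(4) by (auto simp: tuples_def)
qed

text \<open>One pair \<open>(p, q)\<close> is repaired at a time: the new member follows
  \<open>g'\<close>, correct on \<open>{p, q}\<close>, where the two values form a pair forced by
  \<open>(p, q)\<close> or \<open>(q, p)\<close>, and otherwise keeps \<open>g\<close>.\<close>

lemma agree_on_pairs:
  assumes restr: "\<And>B. B \<in> two_subsets A \<Longrightarrow> restr F B = restr G B" and f: "(n, f) \<in> G"
  shows "\<exists>g. (n, g) \<in> F \<and> (\<forall>p\<in>A. \<forall>q\<in>A. p \<noteq> q \<longrightarrow> (\<forall>a\<in>tuples {p, q} n. f a = g a))"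
proof -
  have "n > 0" using G.value_in_set[OF f, of "[]"] by (cases n) (auto simp: tuples_def)
  define P where "P = {(p, q). p \<in> A \<and> q \<in> A \<and> p \<noteq> q}"
  have fin_P: "finite P" by (rule finite_subset[of _ "A \<times> A"]) (auto simp: P_def F.fin)
  have "\<exists>g. (n, g) \<in> F \<and> (\<forall>(p, q)\<in>M. \<forall>a\<in>tuples {p, q} n. f a = g a)"
    if "finite M" "M \<subseteq> P" for M
    using that
  proof (induction M rule: finite_induct)
    case empty
    then show ?case using F.projection[OF \<open>n > 0\<close>] by blast
  next
    case (insert e M)
    obtain p q where e: "e = (p, q)" by force
    then have pq: "p \<in> A" "q \<in> A" "p \<noteq> q" using insert.prems by (auto simp: P_def)
    obtain g where g: "(n, g) \<in> F" "\<And>x y a. (x, y) \<in> M \<Longrightarrow> a \<in> tuples {x, y} n \<Longrightarrow> f a = g a"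
      using insert by blast
    have "{p, q} \<in> two_subsets A" using pq by (simp add: two_subsets_def)
    then obtain g' where g': "(n, g') \<in> F" "\<forall>a\<in>tuples {p, q} n. f a = g' a"
      using restr_eq_agree[OF restr f] by metis
    then have g'_swap: "\<forall>a\<in>tuples {q, p} n. f a = g' a" by (simp add: insert_commute)
    obtain d where d: "(2, d) \<in> F"
      "\<And>x y. x \<in> A \<Longrightarrow> y \<in> A \<Longrightarrow> x \<noteq> y \<Longrightarrow> d [x, y] = (if F.forces p q x y then y else x)"
      using F.forcing_selector[OF pq(3,1,2)] by blast
    obtain d' where d': "(2, d') \<in> F"
      "\<And>x y. x \<in> A \<Longrightarrow> y \<in> A \<Longrightarrow> x \<noteq> y \<Longrightarrow> d' [x, y] = (if F.forces q p x y then y else x)"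
      using F.forcing_selector[of q p] pq by blast
    obtain h1 where h1: "(n, h1) \<in> F" "\<And>a. a \<in> tuples A n \<Longrightarrow> h1 a = d [g a, g' a]"
      using F.composition2[OF d(1) g(1) g'(1)] by blast
    obtain h where h: "(n, h) \<in> F" "\<And>a. a \<in> tuples A n \<Longrightarrow> h a = d' [h1 a, g' a]"
      using F.composition2[OF d'(1) h1(1) g'(1)] by blast
    have h_value: "h a = (if F.forces p q (g a) (g' a) \<or> F.forces q p (g a) (g' a) then g' a else g a)"
      if a: "a \<in> tuples A n" for a
    proof -
      have A: "g a \<in> A" "g' a \<in> A" using F.value_in_carrier a g g' by blast+
      have "d [x, x] = x" "d' [x, x] = x" if "x \<in> A" for x
        using F.binary_value d(1) d'(1) that by blast+
      then show ?thesis using h(2)[OF a] h1(2)[OF a] d(2)[OF A] d'(2)[OF A] A by (cases "g a = g' a") auto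
    qed
    have "f a = h a" if xy: "(x, y) \<in> insert e M" and a: "a \<in> tuples {x, y} n" for x y a
    proof -
      have xyA: "x \<in> A" "y \<in> A" "x \<noteq> y" using xy insert.prems by (auto simp: P_def)
      then have aA: "a \<in> tuples A n" using a by (auto simp: tuples_def)
      have vals: "g a \<in> {x, y}" "g' a \<in> {x, y}"
        using F.value_in_set[OF _ aA] g(1) g'(1) a by (fastforce simp: tuples_def)+
      have refl: "F.forces p q p q" "F.forces q p q p" by (simp_all add: F.forces_def)
      show ?thesis
      proof (cases "F.forces p q (g a) (g' a) \<or> F.forces q p (g a) (g' a)")
        case True
        \<comment> \<open>Correctness of \<open>g'\<close> spreads from \<open>{p, q}\<close> to
          every pair in the two classes, so earlier pairs are not spoiled.\<close>
        have "f a = g' a" if ne: "g a \<noteq> g' a"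
        proof -
          have "a \<in> tuples {g a, g' a} n" "g a \<in> A" "g' a \<in> A"
            using vals ne a xyA by (auto simp: tuples_def)
          then show ?thesis
            using True ne pq agreement_transfer[OF _ _ ne _ _ _ _ f g'(1)] g'(2) g'_swap by metis
        qed
        moreover have "f a = g a" if "g a = g' a"
          using g(2)[of x y a] g'(2) xy e a that by auto
        ultimately show ?thesis using h_value[OF aA] True by (cases "g a = g' a") auto
      next
        case False
        then have "f a = g a"
          using xy e g(2)[of x y a] g'(2) a vals refl by auto
        then show ?thesis using h_value[OF aA] False by simp
      qed
    qed
    then show ?case using h(1) by blast
  qed
  from this[OF fin_P] show ?thesis by (fastforce simp: P_def)
qed

end

subsection \<open>Trivial binary operations\<close>

context conservative_symmetric_clone
begin

definition minority :: "('a list \<Rightarrow> 'a) \<Rightarrow> bool" where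
  "minority m \<longleftrightarrow> (3, m) \<in> F \<and> (\<forall>x\<in>A. \<forall>y\<in>A. m [x, x, y] = y \<and> m [x, y, x] = y \<and> m [y, x, x] = y)"

lemma permute_ternary:
  assumes "(3, m) \<in> F" "i < 3" "j < 3" "k < 3"
  shows "\<exists>m'. (3, m') \<in> F \<and> (\<forall>x\<in>A. \<forall>y\<in>A. \<forall>z\<in>A.
    m' [x, y, z] = m [[x, y, z] ! i, [x, y, z] ! j, [x, y, z] ! k])"
proof -
  obtain m' where m': "(3, m') \<in> F" "\<And>x. x \<in> tuples A 3 \<Longrightarrow> m' x = m (map ((!) x) [i, j, k])"
    using minor[OF assms(1), of "[i, j, k]" 3] assms by auto
  then have "\<forall>x\<in>A. \<forall>y\<in>A. \<forall>z\<in>A. m' [x, y, z] = m [[x, y, z] ! i, [x, y, z] ! j, [x, y, z] ! k]"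
    by (simp add: tuples_def)
  then show ?thesis using m'(1) by blast
qed

lemma semiprojection_if_minority:
  assumes "minority m" "3 \<le> card A"
  shows "\<exists>s. semiprojection 3 s"
proof -
  obtain B where "B \<subseteq> A" "card B = 3" using obtain_subset_with_card_n[OF assms(2)] by blast
  then obtain p q z where A: "p \<in> A" "q \<in> A" "z \<in> A" and ne: "p \<noteq> q" "p \<noteq> z" "q \<noteq> z"
    by (auto simp: card_3_iff)
  have m: "(3, m) \<in> F" using assms(1) by (simp add: minority_def)
  \<comment> \<open>Once the value sits at the middle place, the operation \<open>s\<close> below
    takes the value \<open>m' [q, q, z] = z\<close> at \<open>[p, q, z]\<close>; a value at the
    first place would only return \<open>p\<close>.\<close>
  have "\<exists>m' p q z. minority m' \<and> distinct [p, q, z] \<and> p \<in> A \<and> q \<in> A \<and> z \<in> A \<and> m' [p, q, z] = q"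
  proof -
    have "m [p, q, z] \<in> {p, q, z}"
      using value_in_set[OF m, of "[p, q, z]"] A by (auto simp: tuples_def)
    then consider "m [p, q, z] = q" | "m [p, q, z] = p" | "m [p, q, z] = z" by blast
    then show ?thesis
    proof cases
      case 1
      then show ?thesis using assms(1) A ne by (intro exI[of _ m] exI[of _ p] exI[of _ q] exI[of _ z]) simp
    next
      case 2
      obtain m' where m': "(3, m') \<in> F" "\<forall>x\<in>A. \<forall>y\<in>A. \<forall>z\<in>A. m' [x, y, z] = m [y, x, z]"
        using permute_ternary[OF m, of 1 0 2] by auto
      then have "minority m'" using assms(1) by (simp add: minority_def)
      then show ?thesis using m' 2 A ne by (intro exI[of _ m'] exI[of _ q] exI[of _ p] exI[of _ z]) auto
    next
      case 3
      obtain m' where m': "(3, m') \<in> F" "\<forall>x\<in>A. \<forall>y\<in>A. \<forall>z\<in>A. m' [x, y, z] = m [x, z, y]"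
        using permute_ternary[OF m, of 0 2 1] by auto
      then have "minority m'" using assms(1) by (simp add: minority_def)
      then show ?thesis using m' 3 A ne by (intro exI[of _ m'] exI[of _ p] exI[of _ z] exI[of _ q]) auto
    qed
  qed
  then obtain m' p q z where m': "minority m'" and dist: "distinct [p, q, z]"
    and A': "p \<in> A" "q \<in> A" "z \<in> A" and eq: "m' [p, q, z] = q" by blast
  obtain u v w where pr: "(3, u) \<in> F" "(3, v) \<in> F" "(3, w) \<in> F"
    "\<And>x y z. x \<in> A \<Longrightarrow> y \<in> A \<Longrightarrow> z \<in> A \<Longrightarrow> u [x, y, z] = x \<and> v [x, y, z] = y \<and> w [x, y, z] = z"
    using ternary_projections by blast
  have m3: "(3, m') \<in> F" using m' by (simp add: minority_def)
  obtain s where s: "(3, s) \<in> F" "\<And>x. x \<in> tuples A 3 \<Longrightarrow> s x = m' [m' x, v x, w x]"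
    using composition3[OF m3 m3 pr(2,3)] by blast
  \<comment> \<open>On two-element sets \<open>m'\<close> is addition modulo 2, and \<open>(x + y + z) + y + z = x\<close>.\<close>
  have s': "s [x, y, z] = m' [m' [x, y, z], y, z]" if "x \<in> A" "y \<in> A" "z \<in> A" for x y z
    using s(2)[of "[x, y, z]"] pr(4) that by (simp add: tuples_def)
  have "semiprojection 3 s"
  proof (rule ternary_semiprojectionI[OF s(1), of p q z])
    show "s [x, x, y] = x \<and> s [x, y, x] = x \<and> s [x, y, y] = x" if "x \<in> A" "y \<in> A" for x y
      using m' that by (simp add: s' minority_def)
    show "s [p, q, z] \<noteq> p" using s' A' eq m' dist by (auto simp: minority_def)
  qed (use A' in auto)
  then show ?thesis by blast
qed

text \<open>\<open>t\<close> acts as a minority when the odd entry is first or second, and as a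
  majority when it is third. The composite \<open>t [x, z, t [x, z, y]]\<close> is a majority in all
  three patterns.\<close>

lemma majority_if_two_absorbing:
  assumes t: "(3, t) \<in> F" and "\<And>x y. x \<in> A \<Longrightarrow> y \<in> A \<Longrightarrow> t [x, y, y] = x \<and> t [y, x, y] = x \<and> t [y, y, x] = y"
  shows "\<exists>m. majority m"
proof -
  obtain u v w where pr: "(3, u) \<in> F" "(3, v) \<in> F" "(3, w) \<in> F"
    "\<And>x y z. x \<in> A \<Longrightarrow> y \<in> A \<Longrightarrow> z \<in> A \<Longrightarrow> u [x, y, z] = x \<and> v [x, y, z] = y \<and> w [x, y, z] = z"
    using ternary_projections by blast
  obtain t' where t': "(3, t') \<in> F" "\<forall>x\<in>A. \<forall>y\<in>A. \<forall>z\<in>A. t' [x, y, z] = t [x, z, y]"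
    using permute_ternary[OF t, of 0 2 1] by auto
  obtain m where m: "(3, m) \<in> F" "\<And>x. x \<in> tuples A 3 \<Longrightarrow> m x = t [u x, w x, t' x]"
    using composition3[OF t pr(1,3) t'(1)] by blast
  have m': "m [x, y, z] = t [x, z, t [x, z, y]]" if "x \<in> A" "y \<in> A" "z \<in> A" for x y z
    using m(2)[of "[x, y, z]"] pr(4) t'(2) that by (simp add: tuples_def)
  have "majority m" using assms m(1) by (simp add: majority_def m')
  then show ?thesis by blast
qed

lemma projection_on_pair:
  assumes triv: "binary_trivial A F" and "\<nexists>m. majority m" and "\<nexists>m. minority m"
    and f: "(n, f) \<in> F" and pq: "p \<noteq> q" "p \<in> A" "q \<in> A"
  shows "\<exists>i<n. \<forall>a\<in>tuples {p, q} n. f a = a ! i"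
proof -
  \<comment> \<open>\<open>W X x y\<close> is the value of \<open>f\<close> at the tuple that is
    \<open>x\<close> on \<open>X\<close> and \<open>y\<close> elsewhere. As binary members are
    trivial, whether it equals \<open>x\<close> depends, for \<open>x\<close> and \<open>y\<close>
    distinct, only on \<open>X\<close>.\<close>
  define W where "W X x y = f (map (\<lambda>i. if i \<in> X then x else y) [0..<n])" for X :: "nat set" and x y
  define U where "U X \<longleftrightarrow> W X p q = p" for X
  have W: "W X x y = (if U X then x else y)" if "x \<in> A" "y \<in> A" for X x y
  proof -
    obtain t where t: "(2, t) \<in> F"
      "\<forall>x\<in>A. \<forall>y\<in>A. t [x, y] = f (map (\<lambda>b. if b then x else y) (map (\<lambda>i. i \<in> X) [0..<n]))"
      using binary_minor[OF f, of "map (\<lambda>i. i \<in> X) [0..<n]"] by auto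
    then have "\<forall>x\<in>A. \<forall>y\<in>A. t [x, y] = W X x y" by (simp add: W_def comp_def)
    then show ?thesis using triv t(1) pq that unfolding binary_trivial_def U_def by metis
  qed
  \<comment> \<open>The three variables are placed on \<open>X\<close>, on \<open>Y\<close> and on
    the remaining coordinates.\<close>
  have ternary: "\<exists>t. (3, t) \<in> F \<and> (\<forall>x\<in>A. \<forall>y\<in>A. t [x, y, y] = (if U X then x else y) \<and>
      t [y, x, y] = (if U Y then x else y) \<and> t [y, y, x] = (if U (X \<union> Y) then y else x))"
    if disj: "X \<inter> Y = {}" for X Y
  proof -
    let ?js = "map (\<lambda>i. if i \<in> X then 0 else if i \<in> Y then 1 else 2) [0..<n]"
    obtain t where t: "(3, t) \<in> F" "\<And>x. x \<in> tuples A 3 \<Longrightarrow> t x = f (map ((!) x) ?js)"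
    proof -
      have "set ?js \<subseteq> {..<3::nat}" by auto
      then show ?thesis using minor[OF f, of ?js 3] that by auto
    qed
    have "t [x, y, y] = W X x y \<and> t [y, x, y] = W Y x y \<and> t [y, y, x] = W (X \<union> Y) y x"
      if "x \<in> A" "y \<in> A" for x y
      using t(2)[of "[x, y, y]"] t(2)[of "[y, x, y]"] t(2)[of "[y, y, x]"] that disj
      unfolding W_def by (auto simp: tuples_def intro!: arg_cong[of _ _ f])
    then show ?thesis using t(1) W by (intro exI[of _ t]) auto
  qed
  have "U {..<n}"
  proof -
    let ?x = "map (\<lambda>i. if i \<in> {..<n} then p else q) [0..<n]"
    have "?x \<in> tuples A n" using pq by (auto simp: tuples_def)
    then have "f ?x \<in> set ?x" by (rule value_in_set[OF f])
    then show ?thesis by (auto simp: U_def W_def)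
  qed
  \<comment> \<open>\<open>U\<close> is the family of coordinate sets that decide \<open>f\<close> on two-valued tuples. A smallest member is a
    singleton, since splitting it would give a majority; a member disjoint from that singleton would
    give a minority, or an operation that generates a majority.\<close>
  then obtain X where X: "X \<subseteq> {..<n}" "U X" and least: "\<And>Y. Y \<subseteq> {..<n} \<Longrightarrow> U Y \<Longrightarrow> card X \<le> card Y"
    using ex_has_least_nat[of "\<lambda>X. X \<subseteq> {..<n} \<and> U X" "{..<n}" card] by auto
  have "finite X" using X(1) finite_subset by blast
  have smaller: "\<not> U Y" if "Y \<subset> X" for Y
    using least[of Y] psubset_card_mono[OF \<open>finite X\<close> that] X(1) that by auto
  have "\<not> U {}"
  proof -
    let ?x = "map (\<lambda>i. if i \<in> {} then p else q) [0..<n]"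
    have "?x \<in> tuples A n" using pq by (auto simp: tuples_def)
    then have "f ?x \<in> set ?x" by (rule value_in_set[OF f])
    then show ?thesis using pq by (auto simp: U_def W_def)
  qed
  then obtain i where i: "i \<in> X" using X(2) by (cases "X = {}") auto
  have "X = {i}"
  proof (rule ccontr)
    assume "X \<noteq> {i}"
    then have "\<not> U {i}" "\<not> U (X - {i})" using smaller i by auto
    moreover have "{i} \<union> (X - {i}) = X" using i by blast
    ultimately obtain t where "(3, t) \<in> F"
        "\<forall>x\<in>A. \<forall>y\<in>A. t [x, y, y] = y \<and> t [y, x, y] = y \<and> t [y, y, x] = y"
      using ternary[of "{i}" "X - {i}"] X(2) by auto
    then have "majority t" by (simp add: majority_def)
    then show False using assms(2) by blast
  qed
  have no: "\<not> U Y" if notin: "i \<notin> Y" for Y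
  proof
    assume "U Y"
    then obtain t where t: "(3, t) \<in> F" "\<forall>x\<in>A. \<forall>y\<in>A. t [x, y, y] = x \<and> t [y, x, y] = x \<and>
        t [y, y, x] = (if U ({i} \<union> Y) then y else x)"
      using ternary[of "{i}" Y] X(2) \<open>X = {i}\<close> notin by auto
    show False
    proof (cases "U ({i} \<union> Y)")
      case True
      then show False using majority_if_two_absorbing[OF t(1)] t(2) assms(2) by auto
    next
      case False
      then have "minority t" using t by (simp add: minority_def)
      then show False using assms(3) by blast
    qed
  qed
  \<comment> \<open>The complement of \<open>Y\<close> misses \<open>i\<close>, so it does not
    decide. Its elements beyond \<open>n\<close> are harmless, as \<open>W\<close> inspects only
    places below \<open>n\<close>.\<close>
  have yes: "U Y" if "i \<in> Y" for Y
  proof -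
    have "\<not> U (- Y)" using no that by simp
    then have "W (- Y) q p = p" using W pq by simp
    moreover have "W (- Y) q p = W Y p q" by (auto simp: W_def intro!: arg_cong[of _ _ f])
    ultimately show ?thesis by (simp add: U_def)
  qed
  have "f a = a ! i" if a: "a \<in> tuples {p, q} n" for a
  proof -
    let ?Y = "{j. a ! j = p}"
    have nth: "a ! j = p \<or> a ! j = q" if "j < n" for j using a that by (auto simp: tuples_def subset_iff)
    have "a = map (\<lambda>j. if j \<in> ?Y then p else q) [0..<n]"
      using a nth by (intro nth_equalityI) (auto simp: tuples_def)
    then have "f a = W ?Y p q" by (simp add: W_def)
    also have "\<dots> = a ! i" using W[OF pq(2,3), of ?Y] yes[of ?Y] no[of ?Y] nth[of i] i X(1) by auto
    finally show ?thesis .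
  qed
  then show ?thesis using i X(1) by blast
qed

lemma is_proj_iff:
  assumes "(n, f) \<in> F"
  shows "is_proj A (n, f) \<longleftrightarrow> (\<exists>i<n. \<forall>x\<in>tuples A n. f x = x ! i)"
proof -
  have "(n, f) = proj A n i \<longleftrightarrow> (\<forall>x\<in>tuples A n. f x = x ! i)" for i
    using in_ops[OF assms] by (fastforce simp: proj_def ops_def)
  then show ?thesis by (simp add: is_proj_def)
qed

text \<open>Listing the distinct entries of \<open>a\<close> factors \<open>f\<close> at
  \<open>a\<close> through a minor \<open>g\<close> of arity below \<open>r\<close>, which is a
  projection. The values of \<open>f\<close> over \<open>{p, q}\<close> identify its
  coordinate.\<close>

lemma projection_below_rank:
  assumes below: "\<And>m g. m < r \<Longrightarrow> (m, g) \<in> F \<Longrightarrow> is_proj A (m, g)"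
    and f: "(n, f) \<in> F" and pq: "p \<noteq> q" "p \<in> A" "q \<in> A"
    and i: "i < n" "\<And>a. a \<in> tuples {p, q} n \<Longrightarrow> f a = a ! i"
    and a: "a \<in> tuples A n" "card (set a) < r"
  shows "f a = a ! i"
proof -
  obtain ys where ys: "set ys = set a" "distinct ys"
    using finite_distinct_list[of "set a"] by auto
  define m where "m = length ys"
  have "m < r" using a(2) ys by (simp add: m_def distinct_card[symmetric])
  have len: "length a = n" using a(1) by (simp add: tuples_def)
  have "\<exists>k<m. ys ! k = a ! j" if "j < n" for j
    using that ys(1) len nth_mem[of j a] by (metis in_set_conv_nth m_def)
  then obtain k where k: "\<And>j. j < n \<Longrightarrow> k j < m \<and> ys ! k j = a ! j" by metis
  obtain g where g: "(m, g) \<in> F" "\<And>x. x \<in> tuples A m \<Longrightarrow> g x = f (map ((!) x) (map k [0..<n]))"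
  proof -
    have "set (map k [0..<n]) \<subseteq> {..<m}" using k by auto
    then show ?thesis using minor[OF f, of "map k [0..<n]" m] that by auto
  qed
  obtain l where l: "l < m" "\<And>x. x \<in> tuples A m \<Longrightarrow> g x = x ! l"
    using below[OF \<open>m < r\<close> g(1)] is_proj_iff[OF g(1)] by blast
  \<comment> \<open>The entry \<open>p\<close> marks only place \<open>k i\<close>, so comparing
    \<open>g\<close> and \<open>f\<close> here yields \<open>l = k i\<close>.\<close>
  define x where "x = map (\<lambda>j. if j = k i then p else q) [0..<m]"
  have x: "x \<in> tuples A m" using pq by (auto simp: x_def tuples_def)
  have "map ((!) x) (map k [0..<n]) \<in> tuples {p, q} n"
    using k by (auto simp: x_def tuples_def)
  then have "x ! l = x ! k i" using g(2)[OF x] l(2)[OF x] i by simp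
  then have "l = k i" using l(1) k[OF i(1)] pq(1) by (auto simp: x_def split: if_splits)
  moreover have "map ((!) ys) (map k [0..<n]) = a"
    using k len by (intro nth_equalityI) auto
  moreover have "ys \<in> tuples A m" using a(1) ys by (auto simp: tuples_def m_def)
  ultimately show ?thesis using g(2)[of ys] l(2)[of ys] k[OF i(1)] by simp
qed

text \<open>A tuple with a repetition has fewer than \<open>r\<close> distinct entries, so
  \<open>s\<close> acts there as projection \<open>i\<close>. Exchanging arguments 0 and
  \<open>i\<close> gives the standard form.\<close>

lemma semiprojection_at_rank:
  assumes below: "\<And>m g. m < r \<Longrightarrow> (m, g) \<in> F \<Longrightarrow> is_proj A (m, g)"
    and s: "(r, s) \<in> F" "\<not> is_proj A (r, s)" and pq: "p \<noteq> q" "p \<in> A" "q \<in> A"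
    and i: "i < r" "\<And>a. a \<in> tuples {p, q} r \<Longrightarrow> s a = a ! i"
  shows "\<exists>s'. semiprojection r s'"
proof -
  define swap where "swap j = (if j = 0 then i else if j = i then 0 else j)" for j
  let ?perm = "\<lambda>x. map ((!) x) (map swap [0..<r])"
  have swap: "swap (swap j) = j" "j < r \<Longrightarrow> swap j < r" for j using i(1) by (auto simp: swap_def)
  obtain s' where s': "(r, s') \<in> F" "\<And>x. x \<in> tuples A r \<Longrightarrow> s' x = s (?perm x)"
  proof -
    have "set (map swap [0..<r]) \<subseteq> {..<r}" using swap(2) by auto
    then show ?thesis using minor[OF s(1), of "map swap [0..<r]" r] that by auto
  qed
  have perm_in: "?perm x \<in> tuples A r" "set (?perm x) \<subseteq> set x" if "x \<in> tuples A r" for x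
    using that swap by (auto simp: tuples_def)
  have perm_perm: "?perm (?perm x) = x" if "x \<in> tuples A r" for x
    using that swap by (intro nth_equalityI) (auto simp: tuples_def)
  have "s' x = x ! 0" if x: "x \<in> tuples A r" "\<not> distinct x" for x
  proof -
    have "card (set x) < r" using x card_distinct[of x] card_length[of x] by (fastforce simp: tuples_def)
    then have "card (set (?perm x)) < r"
      using card_mono[OF _ perm_in(2)[OF x(1)]] by simp
    from projection_below_rank[OF _ s(1) pq i perm_in(1)[OF x(1)] this]
    have "s (?perm x) = ?perm x ! i" using below by blast
    then show ?thesis using s'(2)[OF x(1)] i(1) by (simp add: swap_def)
  qed
  moreover obtain x where x: "x \<in> tuples A r" "s x \<noteq> x ! i"
    using s is_proj_iff i(1) by blast
  moreover have "s' (?perm x) = s x" using s'(2)[OF perm_in(1)[OF x(1)]] perm_perm[OF x(1)] by simp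
  moreover have "?perm x ! 0 = x ! i" using i(1) by (simp add: swap_def)
  ultimately show ?thesis
    unfolding semiprojection_def using s'(1) perm_in(1)[OF x(1)] by metis
qed

end

section \<open>Rank and the comparison of both clones\<close>

lemma le_Least_iff:
  fixes P :: "nat \<Rightarrow> bool"
  assumes "\<exists>n. P n"
  shows "r \<le> Least P \<longleftrightarrow> (\<forall>m<r. \<not> P m)"
proof
  show "\<forall>m<r. \<not> P m" if "r \<le> Least P" using that not_less_Least less_le_trans by blast
  show "r \<le> Least P" if "\<forall>m<r. \<not> P m" using that LeastI_ex[OF assms] not_le by blast
qed

lemma le_rk_iff: "enat r \<le> rk A F \<longleftrightarrow> (\<forall>m<r. \<forall>f. (m, f) \<in> F \<longrightarrow> is_proj A (m, f))"
proof (cases "\<exists>p\<in>F. \<not> is_proj A p")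
  case True
  let ?P = "\<lambda>n. \<exists>f. (n, f) \<in> F \<and> \<not> is_proj A (n, f)"
  have "\<exists>n. ?P n" using True by force
  then have "r \<le> Least ?P \<longleftrightarrow> (\<forall>m<r. \<not> ?P m)" by (rule le_Least_iff)
  then show ?thesis using True by (simp add: rk_def)
next
  case False
  then show ?thesis by (auto simp: rk_def)
qed

context clone_pair
begin

lemma members_subset:
  assumes card: "3 \<le> card A" and D: "Drel A F = Drel A G" and rk: "rk A F = rk A G"
    and restr: "\<And>B. B \<in> two_subsets A \<Longrightarrow> restr F B = restr G B"
  shows "G \<subseteq> F"
proof
  fix P assume "P \<in> G"
  then obtain n f where P: "P = (n, f)" and f: "(n, f) \<in> G" by (cases P) auto
  obtain g where g: "(n, g) \<in> F" "\<And>p q. p \<in> A \<Longrightarrow> q \<in> A \<Longrightarrow> p \<noteq> q \<Longrightarrow> \<forall>a\<in>tuples {p, q} n. f a = g a"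
    using agree_on_pairs[OF restr f] by blast
  have ternary: "(n, f) \<in> F" if "\<exists>s. F.semiprojection 3 s"
    using that member_if_semiprojection[OF _ _ f g(1)] agree_on_small_tuples[OF g(2) _ f] card by auto
  have "(n, f) \<in> F"
    if triv: "binary_trivial A F" and none: "\<nexists>m. F.majority m" "\<nexists>m. F.minority m"
  proof -
    obtain B where "B \<subseteq> A" "card B = 2" using obtain_subset_with_card_n[of 2 A] card by auto
    then obtain p q where pq: "p \<noteq> q" "p \<in> A" "q \<in> A" by (auto simp: card_2_iff)
    note projection_on_pq = F.projection_on_pair[OF triv none _ pq]
    obtain i where i: "i < n" "\<And>a. a \<in> tuples {p, q} n \<Longrightarrow> g a = a ! i"
      using projection_on_pq[OF g(1)] by blast
    then have f_pq: "\<And>a. a \<in> tuples {p, q} n \<Longrightarrow> f a = a ! i" using g(2) pq by simp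
    obtain pr where pr: "(n, pr) \<in> F" "\<And>x. x \<in> tuples A n \<Longrightarrow> pr x = x ! i"
      using F.projection[OF i(1)] by blast
    \<comment> \<open>The ranks agree, so members of \<open>G\<close> of arity below
      \<open>r\<close> are projections too; hence \<open>f\<close> acts as the same projection
      \<open>i\<close> on tuples with few entries.\<close>
    have low: "f a = pr a"
      if below: "\<forall>m<r. \<forall>h. (m, h) \<in> F \<longrightarrow> is_proj A (m, h)" and a: "a \<in> tuples A n" "card (set a) < r" for r a
    proof -
      have "enat r \<le> rk A G" using below rk le_rk_iff by metis
      then have below_G: "\<And>m h. m < r \<Longrightarrow> (m, h) \<in> G \<Longrightarrow> is_proj A (m, h)" using le_rk_iff by blast
      show ?thesis using G.projection_below_rank[OF below_G f pq i(1) f_pq a] pr(2)[OF a(1)] by simp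
    qed
    show ?thesis
    proof (cases "\<exists>r s. (r, s) \<in> F \<and> \<not> is_proj A (r, s)")
      case True
      define r where "r = (LEAST r. \<exists>s. (r, s) \<in> F \<and> \<not> is_proj A (r, s))"
      obtain s where s: "(r, s) \<in> F" "\<not> is_proj A (r, s)"
        using LeastI_ex[OF True] unfolding r_def by blast
      have below: "\<forall>m<r. \<forall>h. (m, h) \<in> F \<longrightarrow> is_proj A (m, h)"
        unfolding r_def using not_less_Least by blast
      have "r \<noteq> 0" using F.value_in_set[OF s(1), of "[]"] by (auto simp: tuples_def)
      moreover have "r \<noteq> 1"
      proof
        assume "r = 1"
        have "s x = x ! 0" if x: "x \<in> tuples A r" for x
        proof -
          obtain y where "x = [y]" using x \<open>r = 1\<close> by (auto simp: tuples_def length_Suc_conv)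
          then show ?thesis using F.value_in_set[OF s(1) x] by simp
        qed
        then show False using s F.is_proj_iff \<open>r = 1\<close> by (metis zero_less_one)
      qed
      moreover have "r \<noteq> 2"
      proof
        assume "r = 2"
        have "x = [x ! 0, x ! 1] \<and> x ! 0 \<in> A \<and> x ! 1 \<in> A" if "x \<in> tuples A 2" for x
          using that by (auto simp: tuples_def numeral_2_eq_2 length_Suc_conv)
        then have "(\<forall>x\<in>tuples A 2. s x = x ! 0) \<or> (\<forall>x\<in>tuples A 2. s x = x ! 1)"
          using triv s(1) \<open>r = 2\<close> unfolding binary_trivial_def by metis
        then show False using s F.is_proj_iff[OF s(1)] \<open>r = 2\<close> by (metis one_less_numeral_iff pos2 semiring_norm(76))
      qed
      ultimately have "3 \<le> r" by linarith
      obtain j where "j < r" "\<And>a. a \<in> tuples {p, q} r \<Longrightarrow> s a = a ! j"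
        using projection_on_pq[OF s(1)] by blast
      then obtain s' where "F.semiprojection r s'"
        using F.semiprojection_at_rank[OF _ s pq] below by blast
      then show ?thesis
        by (rule member_if_semiprojection[OF _ \<open>3 \<le> r\<close> f pr(1)]) (rule low[OF below])
    next
      case False
      have "f = pr"
      proof (rule op_eqI[OF G.in_ops[OF f] F.in_ops[OF pr(1)]])
        show "f a = pr a" if "a \<in> tuples A n" for a
          \<comment> \<open>All members of \<open>F\<close> are projections, so the bound can be
            chosen above the number of entries of \<open>a\<close>.\<close>
          using low[of "Suc (card (set a))" a] that False by blast
      qed
      then show ?thesis using pr(1) by simp
    qed
  qed
  then have "(n, f) \<in> F"
    using F.semiprojection_if_not_binary_trivial F.semiprojection_if_minority
      member_if_majority[OF _ D _ f] ternary card by blast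
  then show "P \<in> F" using P by simp
qed

end

theorem theorem4:
  fixes A :: "'a set" and F G :: "'a op set"
  assumes "finite A" and "card A \<ge> 2"
    and "clone A F" and "clone A G"
    and "conservative A F" and "conservative A G"
    and "symmetric_clone A F" and "symmetric_clone A G"
    and "chi A F = chi A G"
  shows "F = G"
proof -
  interpret F: conservative_symmetric_clone A F using assms by unfold_locales
  interpret G: conservative_symmetric_clone A G using assms by unfold_locales
  have eq: "rk A F = rk A G" "Rrel A F = Rrel A G" "Drel A F = Drel A G" "Pi_fam A F = Pi_fam A G"
    using assms(9) by (auto simp: chi_def)
  have restr: "restr F B = restr G B" if "B \<in> two_subsets A" for B
    using fun_cong[OF eq(4), of B] that by (simp add: Pi_fam_def Let_def)
  show ?thesis
  proof (cases "card A = 2")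
    case True
    \<comment> \<open>Here \<open>A\<close> is itself a two-element subset, and restriction to it
      loses nothing. Both inclusions are instances.\<close>
    have "H \<subseteq> H'" if H: "restr H' A = restr H A" "H \<subseteq> ops A" "H' \<subseteq> ops A" for H H' :: "'a op set"
    proof
      fix P assume "P \<in> H"
      then obtain n f where P: "P = (n, f)" "(n, f) \<in> H" by (cases P) auto
      then obtain g where g: "(n, g) \<in> H'" "\<And>a. a \<in> tuples A n \<Longrightarrow> g a = f a"
        using restr_eq_agree[OF H(1)] by blast
      then have "g = f" using op_eqI[of n g A f] H P by blast
      then show "P \<in> H'" using g P by simp
    qed
    moreover have "restr F A = restr G A" using restr True by (simp add: two_subsets_def)
    ultimately show ?thesis using F.in_ops G.in_ops by (metis subset_antisym subsetI)
  next
    case False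
    then have "3 \<le> card A" using assms(2) by simp
    interpret FG: clone_pair A F G using eq by unfold_locales
    interpret GF: clone_pair A G F using eq by unfold_locales auto
    show ?thesis
      using FG.members_subset[OF \<open>3 \<le> card A\<close> eq(3,1) restr]
        GF.members_subset[OF \<open>3 \<le> card A\<close> eq(3,1)[symmetric] restr[symmetric]] by (rule subset_antisym[rotated])
  qed
qed

end
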